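(* Let $(X,J)$ be a closed almost complex manifold and let $V$ be a linear subspace of $H^2(X,\mathbb{R})$. If $V$ does not contain the class of a symplectic form taming $J$, then there is a complex cycle $T\neq 0$ on $X$ such that $\langle h,[T]\rangle=0$ for all $h\in V$.
   Context: Closed means compact without boundary. A symplectic form $\omega$ on $X$ tames $J$ if $\omega(v,Jv)>0$ for all nonzero $v\in TX$. A $k$-current on $X$ is a continuous linear functional on the space $\Omega^k_c(X)$ of compactly supported smooth differential $k$-forms, equipped with the strong $C^\infty$-topology (a sequence converges iff it is eventually supported in one compact set and converges in $C^\infty$). The boundary of a current is $\partial T(\alpha):=T(d\alpha)$. Let $\Omega^+(X)\subset\Omega^2_c(X)$ be the set of 2-forms $\omega$ with $\omega(v,Jv)>0$ for all $v\neq 0$ in $TX$. A complex cycle is a 2-current $T$ on $X$ with $\partial T=0$ and $T(\omega)>0$ for all $\omega\in\Omega^+(X)$. For a 2-cycle $T$ (i.e. $\partial T=0$) and $h\in H^2(X,\mathbb{R})$, $\langle h,[T]\rangle:=T(\alpha)$ for any closed 2-form $\alpha$ representing $h$. *)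

theory Defs
  imports "HOL-Analysis.Analysis"
begin

section \<open>Smooth maps between Euclidean spaces\<close>

text \<open>\<open>iter_deriv [v1, ..., vm] f\<close> is the iterated directional derivative of \<open>f\<close>, taken first
  along \<open>v1\<close> and last along \<open>vm\<close>. On an open set, \<open>f\<close> is of class C-infinity iff all of these are
  differentiable (hence continuous).\<close>

fun iter_deriv :: "'e::euclidean_space list \<Rightarrow> ('e \<Rightarrow> 'f::real_normed_vector) \<Rightarrow> 'e \<Rightarrow> 'f" where
  "iter_deriv [] f = f"
| "iter_deriv (v # vs) f = iter_deriv vs (\<lambda>x. frechet_derivative f (at x) v)"

definition smooth_on :: "'e::euclidean_space set \<Rightarrow> ('e \<Rightarrow> 'f::real_normed_vector) \<Rightarrow> bool" where
  "smooth_on S f \<longleftrightarrow> open S \<and> (\<forall>vs. iter_deriv vs f differentiable_on S)"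

section \<open>Closed smooth manifolds\<close>

text \<open>A chart \<open>(U, \<phi>)\<close> consists of its domain and the coordinate map, whose values outside \<open>U\<close> are
  irrelevant. The dimension of the manifold is \<open>DIM('e)\<close>. Charts map onto open subsets of \<open>'e\<close>,
  so that there is no boundary. The atlas \<open>A\<close> need not be maximal; it determines the smooth
  structure.\<close>

type_synonym ('a, 'e) chart = "'a set \<times> ('a \<Rightarrow> 'e)"

definition is_chart :: "'a topology \<Rightarrow> ('a, 'e::euclidean_space) chart \<Rightarrow> bool" where
  "is_chart X c \<longleftrightarrow> openin X (fst c) \<and> open (snd c ` fst c) \<and>
     homeomorphic_map (subtopology X (fst c)) (top_of_set (snd c ` fst c)) (snd c)"

definition chart_inv :: "('a, 'e) chart \<Rightarrow> 'e \<Rightarrow> 'a" where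
  "chart_inv c = inv_into (fst c) (snd c)"

definition transition :: "('a, 'e) chart \<Rightarrow> ('a, 'e) chart \<Rightarrow> 'e \<Rightarrow> 'e" where
  "transition c c' = snd c' \<circ> chart_inv c"

definition smooth_atlas :: "'a topology \<Rightarrow> ('a, 'e::euclidean_space) chart set \<Rightarrow> bool" where
  "smooth_atlas X A \<longleftrightarrow> (\<forall>c\<in>A. is_chart X c) \<and> (\<Union>c\<in>A. fst c) = topspace X \<and>
     (\<forall>c\<in>A. \<forall>c'\<in>A. smooth_on (snd c ` (fst c \<inter> fst c')) (transition c c'))"

definition smooth_manifold :: "'a topology \<Rightarrow> ('a, 'e::euclidean_space) chart set \<Rightarrow> bool" where
  "smooth_manifold X A \<longleftrightarrow> Hausdorff_space X \<and> second_countable X \<and> smooth_atlas X A"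

definition closed_manifold :: "'a topology \<Rightarrow> ('a, 'e::euclidean_space) chart set \<Rightarrow> bool" where
  "closed_manifold X A \<longleftrightarrow> smooth_manifold X A \<and> compact_space X"

definition charts_at :: "('a, 'e) chart set \<Rightarrow> 'a \<Rightarrow> ('a, 'e) chart set" where
  "charts_at A p = {c \<in> A. p \<in> fst c}"

section \<open>Tangent vectors and almost complex structures\<close>

text \<open>A tangent vector at \<open>p\<close> is the family of its coordinate vectors in all charts around \<open>p\<close>, which
  are related by the derivatives of the coordinate changes (and \<open>0\<close> for all other charts, for
  extensionality). The vector space operations are pointwise; \<open>\<lambda>c. 0\<close> is the zero vector.\<close>

type_synonym ('a, 'e) tangent = "('a, 'e) chart \<Rightarrow> 'e"

definition tangent_space ::
  "('a, 'e::euclidean_space) chart set \<Rightarrow> 'a \<Rightarrow> ('a, 'e) tangent set" where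
  "tangent_space A p = {v. (\<forall>c. c \<notin> charts_at A p \<longrightarrow> v c = 0) \<and>
     (\<forall>c\<in>charts_at A p. \<forall>c'\<in>charts_at A p.
        v c' = frechet_derivative (transition c c') (at (snd c p)) (v c))}"

definition tangent_lincomb ::
  "real \<Rightarrow> ('a, 'e::real_vector) tangent \<Rightarrow> real \<Rightarrow> ('a, 'e) tangent \<Rightarrow> ('a, 'e) tangent" where
  "tangent_lincomb a v b w = (\<lambda>c. a *\<^sub>R v c + b *\<^sub>R w c)"

text \<open>The tangent vector at \<open>p\<close> whose coordinate vector in the chart \<open>c\<close> is \<open>e\<close>.\<close>

definition coord_vector ::
  "('a, 'e::euclidean_space) chart set \<Rightarrow> ('a, 'e) chart \<Rightarrow> 'a \<Rightarrow> 'e \<Rightarrow> ('a, 'e) tangent" where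
  "coord_vector A c p e = (\<lambda>c'. if c' \<in> charts_at A p
     then frechet_derivative (transition c c') (at (snd c p)) e else 0)"

definition almost_complex_structure ::
  "'a topology \<Rightarrow> ('a, 'e::euclidean_space) chart set \<Rightarrow>
   ('a \<Rightarrow> ('a, 'e) tangent \<Rightarrow> ('a, 'e) tangent) \<Rightarrow> bool" where
  "almost_complex_structure X A J \<longleftrightarrow>
     (\<forall>p\<in>topspace X. \<forall>v\<in>tangent_space A p.
        J p v \<in> tangent_space A p \<and> J p (J p v) = (\<lambda>c. - v c)) \<and>
     (\<forall>p\<in>topspace X. \<forall>v\<in>tangent_space A p. \<forall>w\<in>tangent_space A p. \<forall>a b.
        J p (tangent_lincomb a v b w) = tangent_lincomb a (J p v) b (J p w)) \<and>
     (\<forall>c\<in>A. \<forall>e. smooth_on (snd c ` fst c)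
        (\<lambda>x. J (chart_inv c x) (coord_vector A c (chart_inv c x) e) c))"

section \<open>Differential forms and the exterior derivative\<close>

text \<open>A \<open>k\<close>-form takes a point and a list of \<open>k\<close> tangent vectors at that point.\<close>

type_synonym ('a, 'e) form = "'a \<Rightarrow> ('a, 'e) tangent list \<Rightarrow> real"

definition local_rep ::
  "('a, 'e::euclidean_space) chart set \<Rightarrow> ('a, 'e) chart \<Rightarrow> ('a, 'e) form \<Rightarrow> 'e \<Rightarrow> 'e list \<Rightarrow> real" where
  "local_rep A c \<alpha> x es = \<alpha> (chart_inv c x) (map (coord_vector A c (chart_inv c x)) es)"

definition tangent_tuples ::
  "('a, 'e::euclidean_space) chart set \<Rightarrow> nat \<Rightarrow> 'a \<Rightarrow> ('a, 'e) tangent list set" where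
  "tangent_tuples A k p = {vs. length vs = k \<and> set vs \<subseteq> tangent_space A p}"

text \<open>The first condition only normalises the values of \<open>\<alpha>\<close> on arguments without meaning, so that
  equality of functions is equality of forms.\<close>

definition smooth_forms ::
  "'a topology \<Rightarrow> ('a, 'e::euclidean_space) chart set \<Rightarrow> nat \<Rightarrow> ('a, 'e) form set" where
  "smooth_forms X A k = {\<alpha>.
     (\<forall>p vs. p \<notin> topspace X \<or> vs \<notin> tangent_tuples A k p \<longrightarrow> \<alpha> p vs = 0) \<and>
     (\<forall>p\<in>topspace X. \<forall>vs\<in>tangent_tuples A k p. \<forall>i<k.
        \<forall>v\<in>tangent_space A p. \<forall>w\<in>tangent_space A p. \<forall>a b.
          \<alpha> p (vs[i := tangent_lincomb a v b w]) = a * \<alpha> p (vs[i := v]) + b * \<alpha> p (vs[i := w])) \<and>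
     (\<forall>p\<in>topspace X. \<forall>vs\<in>tangent_tuples A k p. \<forall>i<k. \<forall>j<k.
        i \<noteq> j \<and> vs ! i = vs ! j \<longrightarrow> \<alpha> p vs = 0) \<and>
     (\<forall>c\<in>A. \<forall>es. length es = k \<longrightarrow> smooth_on (snd c ` fst c) (\<lambda>x. local_rep A c \<alpha> x es))}"

definition form_support :: "'a topology \<Rightarrow> ('a, 'e) form \<Rightarrow> 'a set" where
  "form_support X \<alpha> = X closure_of {p \<in> topspace X. \<exists>vs. \<alpha> p vs \<noteq> 0}"

definition compact_forms ::
  "'a topology \<Rightarrow> ('a, 'e::euclidean_space) chart set \<Rightarrow> nat \<Rightarrow> ('a, 'e) form set" where
  "compact_forms X A k = {\<alpha> \<in> smooth_forms X A k. compactin X (form_support X \<alpha>)}"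

definition form_lincomb ::
  "real \<Rightarrow> ('a, 'e) form \<Rightarrow> real \<Rightarrow> ('a, 'e) form \<Rightarrow> ('a, 'e) form" where
  "form_lincomb a \<alpha> b \<beta> = (\<lambda>p vs. a * \<alpha> p vs + b * \<beta> p vs)"

text \<open>In local coordinates the exterior derivative of a \<open>k\<close>-form is
  \<open>(d\<alpha>)_x(v_0, ..., v_k) = \<Sum>i\<le>k. (-1)^i * D_x[\<alpha>(v_0, ..., v_{i-1}, v_{i+1}, ..., v_k)](v_i)\<close>
  with constant \<open>v_0, ..., v_k\<close>. This does not depend on the chart, so any chart around \<open>p\<close> may be
  chosen.\<close>

definition ext_deriv ::
  "'a topology \<Rightarrow> ('a, 'e::euclidean_space) chart set \<Rightarrow> nat \<Rightarrow> ('a, 'e) form \<Rightarrow> ('a, 'e) form" where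
  "ext_deriv X A k \<alpha> = (\<lambda>p vs.
     if p \<in> topspace X \<and> vs \<in> tangent_tuples A (Suc k) p then
       let c = (SOME c. c \<in> charts_at A p); us = map (\<lambda>v. v c) vs
       in \<Sum>i\<le>k. (-1) ^ i *
            frechet_derivative (\<lambda>x. local_rep A c \<alpha> x (take i us @ drop (Suc i) us))
              (at (snd c p)) (us ! i)
     else 0)"

section \<open>De Rham cohomology\<close>

definition closed_forms ::
  "'a topology \<Rightarrow> ('a, 'e::euclidean_space) chart set \<Rightarrow> nat \<Rightarrow> ('a, 'e) form set" where
  "closed_forms X A k = {\<alpha> \<in> smooth_forms X A k. ext_deriv X A k \<alpha> = (\<lambda>p vs. 0)}"

definition exact_forms ::
  "'a topology \<Rightarrow> ('a, 'e::euclidean_space) chart set \<Rightarrow> nat \<Rightarrow> ('a, 'e) form set" where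
  "exact_forms X A k = (case k of 0 \<Rightarrow> {\<lambda>p vs. 0}
     | Suc j \<Rightarrow> ext_deriv X A j ` smooth_forms X A j)"

definition de_rham_class ::
  "'a topology \<Rightarrow> ('a, 'e::euclidean_space) chart set \<Rightarrow> nat \<Rightarrow> ('a, 'e) form \<Rightarrow> ('a, 'e) form set" where
  "de_rham_class X A k \<alpha> =
     {\<beta> \<in> closed_forms X A k. form_lincomb 1 \<beta> (-1) \<alpha> \<in> exact_forms X A k}"

definition de_rham ::
  "'a topology \<Rightarrow> ('a, 'e::euclidean_space) chart set \<Rightarrow> nat \<Rightarrow> ('a, 'e) form set set" where
  "de_rham X A k = de_rham_class X A k ` closed_forms X A k"

text \<open>A set of cohomology classes is a linear subspace iff it contains the zero class and is closed
  under linear combinations \<open>a[\<alpha>] + b[\<beta>] = [a\<alpha> + b\<beta>]\<close>.\<close>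

definition de_rham_subspace ::
  "'a topology \<Rightarrow> ('a, 'e::euclidean_space) chart set \<Rightarrow> nat \<Rightarrow> ('a, 'e) form set set \<Rightarrow> bool" where
  "de_rham_subspace X A k V \<longleftrightarrow> V \<subseteq> de_rham X A k \<and> de_rham_class X A k (\<lambda>p vs. 0) \<in> V \<and>
     (\<forall>\<alpha>\<in>closed_forms X A k. \<forall>\<beta>\<in>closed_forms X A k. \<forall>a b.
        de_rham_class X A k \<alpha> \<in> V \<and> de_rham_class X A k \<beta> \<in> V \<longrightarrow>
        de_rham_class X A k (form_lincomb a \<alpha> b \<beta>) \<in> V)"

section \<open>Currents\<close>

text \<open>The strong C-infinity topology on compactly supported \<open>k\<close>-forms: a basic neighbourhood of \<open>\<alpha>\<close>
  is given by an order \<open>r\<close> and a locally finite family \<open>F\<close> of triples \<open>(c, K, \<epsilon>)\<close>, where \<open>K\<close> is a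
  compact subset of the domain of the chart \<open>c\<close>; it consists of all \<open>\<beta>\<close> such that on each \<open>K\<close> the
  coefficients of \<open>\<beta> - \<alpha>\<close> in the chart \<open>c\<close> have all partial derivatives of order at most \<open>r\<close>
  bounded by \<open>\<epsilon>\<close>.\<close>

definition control_family ::
  "'a topology \<Rightarrow> ('a, 'e::euclidean_space) chart set \<Rightarrow>
   (('a, 'e) chart \<times> 'a set \<times> real) set \<Rightarrow> bool" where
  "control_family X A F \<longleftrightarrow>
     (\<forall>(c, K, \<epsilon>)\<in>F. c \<in> A \<and> compactin X K \<and> K \<subseteq> fst c \<and> \<epsilon> > 0) \<and>
     (\<forall>p\<in>topspace X. \<exists>W. openin X W \<and> p \<in> W \<and> finite {(c, K, \<epsilon>)\<in>F. K \<inter> W \<noteq> {}})"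

definition strong_nbhd ::
  "'a topology \<Rightarrow> ('a, 'e::euclidean_space) chart set \<Rightarrow> nat \<Rightarrow> ('a, 'e) form \<Rightarrow>
   (('a, 'e) chart \<times> 'a set \<times> real) set \<Rightarrow> nat \<Rightarrow> ('a, 'e) form set" where
  "strong_nbhd X A k \<alpha> F r = {\<beta> \<in> compact_forms X A k.
     \<forall>(c, K, \<epsilon>)\<in>F. \<forall>p\<in>K. \<forall>us\<in>lists Basis. \<forall>es\<in>lists Basis.
       length us \<le> r \<and> length es = k \<longrightarrow>
       \<bar>iter_deriv us (\<lambda>x. local_rep A c \<beta> x es - local_rep A c \<alpha> x es) (snd c p)\<bar> < \<epsilon>}"

definition strong_topology ::
  "'a topology \<Rightarrow> ('a, 'e::euclidean_space) chart set \<Rightarrow> nat \<Rightarrow> ('a, 'e) form topology" where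
  "strong_topology X A k = topology_generated_by
     {strong_nbhd X A k \<alpha> F r | \<alpha> F r. \<alpha> \<in> compact_forms X A k \<and> control_family X A F}"

text \<open>The values of a current outside \<open>compact_forms X A k\<close> are irrelevant.\<close>

definition current ::
  "'a topology \<Rightarrow> ('a, 'e::euclidean_space) chart set \<Rightarrow> nat \<Rightarrow> (('a, 'e) form \<Rightarrow> real) \<Rightarrow> bool" where
  "current X A k T \<longleftrightarrow>
     (\<forall>\<alpha>\<in>compact_forms X A k. \<forall>\<beta>\<in>compact_forms X A k. \<forall>a b.
        T (form_lincomb a \<alpha> b \<beta>) = a * T \<alpha> + b * T \<beta>) \<and>
     continuous_map (strong_topology X A k) euclideanreal T"

definition zero_current ::
  "'a topology \<Rightarrow> ('a, 'e::euclidean_space) chart set \<Rightarrow> nat \<Rightarrow> (('a, 'e) form \<Rightarrow> real) \<Rightarrow> bool" where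
  "zero_current X A k T \<longleftrightarrow> (\<forall>\<alpha>\<in>compact_forms X A k. T \<alpha> = 0)"

text \<open>The boundary of a \<open>(k+1)\<close>-current \<open>T\<close> is the \<open>k\<close>-current \<open>boundary X A k T\<close>.\<close>

definition boundary ::
  "'a topology \<Rightarrow> ('a, 'e::euclidean_space) chart set \<Rightarrow> nat \<Rightarrow>
   (('a, 'e) form \<Rightarrow> real) \<Rightarrow> ('a, 'e) form \<Rightarrow> real" where
  "boundary X A k T = (\<lambda>\<alpha>. T (ext_deriv X A k \<alpha>))"

text \<open>The common value of \<open>T\<close> on the closed forms representing \<open>h\<close>, well defined for cycles \<open>T\<close>.\<close>

definition de_rham_pairing :: "('a, 'e) form set \<Rightarrow> (('a, 'e) form \<Rightarrow> real) \<Rightarrow> real" where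
  "de_rham_pairing h T = (THE t. \<forall>\<alpha>\<in>h. T \<alpha> = t)"

section \<open>Taming forms and complex cycles\<close>

definition tames ::
  "'a topology \<Rightarrow> ('a, 'e::euclidean_space) chart set \<Rightarrow> ('a, 'e) form \<Rightarrow>
   ('a \<Rightarrow> ('a, 'e) tangent \<Rightarrow> ('a, 'e) tangent) \<Rightarrow> bool" where
  "tames X A \<omega> J \<longleftrightarrow>
     (\<forall>p\<in>topspace X. \<forall>v\<in>tangent_space A p. v \<noteq> (\<lambda>c. 0) \<longrightarrow> \<omega> p [v, J p v] > 0)"

definition symplectic_form ::
  "'a topology \<Rightarrow> ('a, 'e::euclidean_space) chart set \<Rightarrow> ('a, 'e) form \<Rightarrow> bool" where
  "symplectic_form X A \<omega> \<longleftrightarrow> \<omega> \<in> closed_forms X A 2 \<and>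
     (\<forall>p\<in>topspace X. \<forall>v\<in>tangent_space A p. v \<noteq> (\<lambda>c. 0) \<longrightarrow>
        (\<exists>w\<in>tangent_space A p. \<omega> p [v, w] \<noteq> 0))"

definition positive_forms ::
  "'a topology \<Rightarrow> ('a, 'e::euclidean_space) chart set \<Rightarrow>
   ('a \<Rightarrow> ('a, 'e) tangent \<Rightarrow> ('a, 'e) tangent) \<Rightarrow> ('a, 'e) form set" where
  "positive_forms X A J = {\<omega> \<in> compact_forms X A 2. tames X A \<omega> J}"

definition complex_cycle ::
  "'a topology \<Rightarrow> ('a, 'e::euclidean_space) chart set \<Rightarrow>
   ('a \<Rightarrow> ('a, 'e) tangent \<Rightarrow> ('a, 'e) tangent) \<Rightarrow> (('a, 'e) form \<Rightarrow> real) \<Rightarrow> bool" where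
  "complex_cycle X A J T \<longleftrightarrow> current X A 2 T \<and> zero_current X A 1 (boundary X A 1 T) \<and>
     (\<forall>\<omega>\<in>positive_forms X A J. T \<omega> > 0)"

end

theory Submission
  imports Defs "HOL-Library.Function_Algebras"
begin

text \<open>The closed 2-forms whose class lies in \<open>V\<close> form a subspace \<open>W\<close> which, by hypothesis, misses the
  convex cone \<open>P\<close> of taming forms. By compactness, small perturbations of a taming form in the
  \<open>C\<^sup>0\<close>-topology are taming, so \<open>P\<close> is open and a linear functional \<open>T\<close> vanishes on \<open>W\<close> and is positive on
  \<open>P\<close>. It is automatically continuous: if \<open>\<omega> \<plusminus> \<beta>\<close> are taming, then
  \<open>\<bar>T \<beta>\<bar> < T \<omega>\<close>. As \<open>W\<close> contains the exact forms, \<open>T\<close> is a cycle, and \<open>T \<noteq> 0\<close> as \<open>P\<close> is not empty.\<close>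

text \<open>The separation is purely algebraic: \<open>P\<close> only has to contain
  \<open>p + \<epsilon> *\<^sub>R x\<close> for some positive \<epsilon>, for each direction x. A
  topology on forms enters only with continuity, where bounds on coefficients suffice. On a compact
  manifold all smooth forms have compact support, so everything takes place in the space of all
  smooth 2-forms. A taming form gives more than \<open>T \<noteq> 0\<close>: it is the vector
  transversal to the hyperplane, and its value bounds \<open>T\<close> in the continuity estimate.
  It is built as a finite sum of local forms; positivity survives sums, which replaces a partition
  of unity. The main obstacle is the exterior derivative. Its definition picks a chart at each point
  with no regularity in the point, so smoothness and closedness of exact forms become visible only
  after independence of the chart is proved. For 1-forms this rests on the symmetry of the second
  derivatives of coordinate changes; closedness uses the same symmetry for the coefficients.\<close>

section \<open>Separation of a subspace from an algebraically open cone\<close>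

text \<open>By Zorn's lemma there is a maximal subspace \<open>M \<supseteq> W\<close> disjoint from \<open>P\<close>; it is a hyperplane, with
  \<open>E = M + \<real> p0\<close> for any \<open>p0\<close> in \<open>P\<close>.\<close>

lemma open_cone_separation:
  fixes E W P :: "'v::real_vector set"
  assumes E: "subspace E" and W: "subspace W" "W \<subseteq> E" and P: "P \<subseteq> E" "P \<noteq> {}"
    and add: "\<And>p q. p \<in> P \<Longrightarrow> q \<in> P \<Longrightarrow> p + q \<in> P"
    and scale: "\<And>p r. p \<in> P \<Longrightarrow> 0 < r \<Longrightarrow> r *\<^sub>R p \<in> P"
    and op: "\<And>p x. p \<in> P \<Longrightarrow> x \<in> E \<Longrightarrow> \<exists>\<epsilon>>0. p + \<epsilon> *\<^sub>R x \<in> P"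
    and disj: "P \<inter> W = {}"
  shows "\<exists>T. (\<forall>x\<in>E. \<forall>y\<in>E. \<forall>a b. T (a *\<^sub>R x + b *\<^sub>R y) = a * T x + b * T y) \<and>
    (\<forall>x\<in>W. T x = 0) \<and> (\<forall>p\<in>P. T p > (0::real))"
proof -
  let ?F = "{M. subspace M \<and> W \<subseteq> M \<and> M \<subseteq> E \<and> P \<inter> M = {}}"
  have "\<exists>M\<in>?F. \<forall>X\<in>?F. M \<subseteq> X \<longrightarrow> X = M"
  proof (rule subset_Zorn)
    fix C assume C: "subset.chain ?F C"
    show "\<exists>U\<in>?F. \<forall>X\<in>C. X \<subseteq> U"
    proof (cases "C = {}")
      case True
      \<comment> \<open>The empty chain is bounded by \<open>W\<close> itself; this is where
        disjointness of \<open>P\<close> and \<open>W\<close> enters.\<close>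
      then show ?thesis using W disj by auto
    next
      case False
      have CF: "C \<subseteq> ?F" and lin: "\<And>M N. M \<in> C \<Longrightarrow> N \<in> C \<Longrightarrow> M \<subseteq> N \<or> N \<subseteq> M"
        using C by (auto simp: subset_chain_def)
      have "subspace (\<Union>C)"
        unfolding subspace_def
      proof (intro conjI ballI allI)
        show "0 \<in> \<Union>C" using False CF by (auto simp: subspace_def)
        fix x assume "x \<in> \<Union>C"
        then obtain M where M: "M \<in> C" "x \<in> M" by blast
        then show "c *\<^sub>R x \<in> \<Union>C" for c using CF subspace_scale[of M x c] by blast
        fix y assume "y \<in> \<Union>C"
        then obtain N where N: "N \<in> C" "y \<in> N" by blast
        have "subspace M" "subspace N" using M N CF by auto
        then show "x + y \<in> \<Union>C"
          using lin[OF M(1) N(1)] M N subspace_add[of M x y] subspace_add[of N x y] by blast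
      qed
      then have "\<Union>C \<in> ?F" using False CF by blast
      then show ?thesis by blast
    qed
  qed
  then obtain M where M: "subspace M" "W \<subseteq> M" "M \<subseteq> E" "P \<inter> M = {}"
    and max: "\<And>N. subspace N \<Longrightarrow> N \<subseteq> E \<Longrightarrow> P \<inter> N = {} \<Longrightarrow> M \<subseteq> N \<Longrightarrow> N = M"
    by (smt (verit) mem_Collect_eq order_trans)
  obtain p0 where p0: "p0 \<in> P" using P by blast
  have p0E: "p0 \<in> E" using p0 P by blast
  have neg: "- m \<notin> P" if "m \<in> M" for m
    using that M(1,4) subspace_neg by blast
  have ex: "\<exists>t. x - t *\<^sub>R p0 \<in> M" if x: "x \<in> E" for x
  proof -
    \<comment> \<open>\<open>S\<close> collects the t for which \<open>x - t *\<^sub>R p0\<close>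
      lies on the positive side of \<open>M\<close>, that is, in \<open>M + P\<close>. Openness of
      \<open>P\<close> at \<open>p0\<close> in the directions \<open>x\<close> and \<open>-x\<close>
      makes \<open>S\<close> nonempty and bounded above. The line leaves the positive side at
      \<open>Sup S\<close>, so the candidate for the coordinate of \<open>x\<close> along
      \<open>p0\<close> is this supremum.\<close>
    define S where "S = {t. \<exists>m\<in>M. \<exists>c\<in>P. x - t *\<^sub>R p0 = m + c}"
    obtain e where e: "e > 0" "p0 + e *\<^sub>R x \<in> P" using op[OF p0 x] by blast
    have "(1/e) *\<^sub>R (p0 + e *\<^sub>R x) \<in> P" using scale e by simp
    moreover have "(1/e) *\<^sub>R (p0 + e *\<^sub>R x) = x - (- (1/e)) *\<^sub>R p0"
      using e by (simp add: algebra_simps)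
    ultimately have "- (1/e) \<in> S" unfolding S_def
      using subspace_0[OF M(1)] by (metis (mono_tags, lifting) add_0 mem_Collect_eq)
    then have Sne: "S \<noteq> {}" by blast
    obtain d where d: "d > 0" "p0 + d *\<^sub>R (- x) \<in> P" using op[OF p0 subspace_neg[OF E x]] by blast
    have d1: "(1/d) *\<^sub>R (p0 + d *\<^sub>R (-x)) \<in> P" using scale d by simp
    have d2: "(1/d) *\<^sub>R (p0 + d *\<^sub>R (-x)) = (1/d) *\<^sub>R p0 - x"
      using d by (simp add: algebra_simps)
    have bd: "t \<le> 1/d" if tS: "t \<in> S" for t
    proof (rule ccontr)
      assume "\<not> t \<le> 1/d"
      then have t: "t - 1/d > 0" by simp
      obtain m c where mc: "m \<in> M" "c \<in> P" "x - t *\<^sub>R p0 = m + c" using tS S_def by blast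
      have "c + (((1/d) *\<^sub>R p0 - x) + (t - 1/d) *\<^sub>R p0) \<in> P"
        using mc d1 d2 t p0 by (intro add scale) auto
      moreover have "c + (((1/d) *\<^sub>R p0 - x) + (t - 1/d) *\<^sub>R p0) = - m"
        using mc(3) by (simp add: algebra_simps)
      ultimately show False using neg[OF mc(1)] by simp
    qed
    have bdd: "bdd_above S" using bd by (auto intro!: bdd_aboveI)
    define a where "a = Sup S"
    define y where "y = x - a *\<^sub>R p0"
    have yE: "y \<in> E" unfolding y_def using E x p0E by (simp add: subspace_diff subspace_scale)
    have shrink: "\<exists>\<epsilon>>0. p - \<epsilon> *\<^sub>R p0 \<in> P" if "p \<in> P" for p
      using op[OF that subspace_neg[OF E p0E]] by simp
    \<comment> \<open>By maximality, a \<open>y\<close> outside \<open>M\<close> yields an element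
      of \<open>P\<close> that differs from \<open>s *\<^sub>R y\<close> by an element of
      \<open>M\<close>. If s > 0, then \<open>y\<close> lies in \<open>M + P\<close> with room to
      spare, and the supremum could be raised. If s < 0, then \<open>-y\<close> lies there; adding
      the decomposition for a point of \<open>S\<close> close to the supremum puts the negative of
      an element of \<open>M\<close> into \<open>P\<close>.\<close>
    have "y \<in> M"
    proof (rule ccontr)
      assume yM: "y \<notin> M"
      let ?N = "span (insert y M)"
      have sub: "M \<subseteq> ?N" "y \<in> ?N" by (auto intro: span_base)
      have "?N \<subseteq> E" using yE M(3) E by (intro span_minimal) auto
      then have "P \<inter> ?N \<noteq> {}" using max[of ?N] sub yM by blast
      then obtain p where p: "p \<in> P" "p \<in> ?N" by blast
      then obtain s where s: "p - s *\<^sub>R y \<in> M"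
        using M(1) by (auto simp: span_insert span_eq_iff[THEN iffD2])
      have "s \<noteq> 0" using s p M(4) by auto
      then consider "s > 0" | "s < 0" by linarith
      then show False
      proof cases
        case 1
        obtain \<epsilon> where eps: "\<epsilon> > 0" "(1/s) *\<^sub>R p - \<epsilon> *\<^sub>R p0 \<in> P"
          using shrink[OF scale[OF p(1), of "1/s"]] 1 by auto
        have "- (1/s) *\<^sub>R (p - s *\<^sub>R y) \<in> M" using s M(1) subspace_scale by blast
        moreover have "x - (a + \<epsilon>) *\<^sub>R p0 = - (1/s) *\<^sub>R (p - s *\<^sub>R y) + ((1/s) *\<^sub>R p - \<epsilon> *\<^sub>R p0)"
          using 1 by (simp add: algebra_simps y_def)
        ultimately have "a + \<epsilon> \<in> S" unfolding S_def using eps by blast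
        then have "a + \<epsilon> \<le> a" unfolding a_def using bdd by (intro cSup_upper)
        then show False using eps by simp
      next
        case 2
        obtain \<epsilon> where eps: "\<epsilon> > 0" "(-1/s) *\<^sub>R p - \<epsilon> *\<^sub>R p0 \<in> P"
          using shrink[OF scale[OF p(1), of "-1/s"]] 2 by (auto simp: field_simps)
        obtain t where t: "t \<in> S" "t > a - \<epsilon>"
          using less_cSup_iff[OF Sne bdd, of "a - \<epsilon>"] eps a_def by auto
        then obtain m c where mc: "m \<in> M" "c \<in> P" "x - t *\<^sub>R p0 = m + c" using S_def by blast
        let ?n = "m + (1/s) *\<^sub>R (p - s *\<^sub>R y)"
        have n: "?n \<in> M" using s M(1) mc by (simp add: subspace_add subspace_scale)
        have "c + (((-1/s) *\<^sub>R p - \<epsilon> *\<^sub>R p0) + (\<epsilon> - (a - t)) *\<^sub>R p0) \<in> P"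
          using mc eps t p0 by (intro add scale) auto
        moreover have "c + (((-1/s) *\<^sub>R p - \<epsilon> *\<^sub>R p0) + (\<epsilon> - (a - t)) *\<^sub>R p0) = - ?n"
        proof -
          have c: "c = x - t *\<^sub>R p0 - m" using mc(3) by simp
          show ?thesis using 2 unfolding c y_def by (simp add: algebra_simps)
        qed
        ultimately show False using neg[OF n] by simp
      qed
    qed
    then show ?thesis unfolding y_def by blast
  qed
  have uniq: "s = t" if "x - s *\<^sub>R p0 \<in> M" "x - t *\<^sub>R p0 \<in> M" for x s t
  proof (rule ccontr)
    assume "s \<noteq> t"
    have "(x - s *\<^sub>R p0) - (x - t *\<^sub>R p0) \<in> M" using that M(1) subspace_diff by blast
    then have "(1/(t-s)) *\<^sub>R ((x - s *\<^sub>R p0) - (x - t *\<^sub>R p0)) \<in> M" using M(1) subspace_scale by blast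
    moreover have "(1/(t-s)) *\<^sub>R ((x - s *\<^sub>R p0) - (x - t *\<^sub>R p0)) = (1/(t-s)) *\<^sub>R ((t - s) *\<^sub>R p0)"
      by (simp add: algebra_simps)
    ultimately have "p0 \<in> M" using \<open>s \<noteq> t\<close> by simp
    then show False using p0 M(4) by blast
  qed
  define T where "T x = (THE t. x - t *\<^sub>R p0 \<in> M)" for x
  have TI: "T x = t" if "x - t *\<^sub>R p0 \<in> M" for x t
    unfolding T_def using that uniq by blast
  have TM: "x - T x *\<^sub>R p0 \<in> M" if "x \<in> E" for x
    using ex[OF that] TI by auto
  show ?thesis
  proof (intro exI[of _ T] conjI ballI allI)
    fix x y a b assume xy: "x \<in> E" "y \<in> E"
    have "a *\<^sub>R (x - T x *\<^sub>R p0) + b *\<^sub>R (y - T y *\<^sub>R p0) \<in> M"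
      using TM xy M(1) by (simp add: subspace_add subspace_scale)
    then show "T (a *\<^sub>R x + b *\<^sub>R y) = a * T x + b * T y"
      by (intro TI) (simp add: algebra_simps)
  next
    fix x assume "x \<in> W"
    then show "T x = 0" using M(2) by (intro TI) auto
  next
    fix p assume p: "p \<in> P"
    \<comment> \<open>If \<open>T p\<close> were at most 0, then \<open>p - T p *\<^sub>R p0\<close>
      would be \<open>p\<close> plus a nonnegative multiple of \<open>p0\<close>, hence in
      \<open>P\<close>, although it lies in \<open>M\<close>.\<close>
    show "T p > 0"
    proof (rule ccontr)
      assume "\<not> T p > 0"
      then consider "T p = 0" | "- T p > 0" by linarith
      then have "p - T p *\<^sub>R p0 \<in> P"
        by cases (use p add[OF p scale[OF p0, of "- T p"]] in auto)
      then show False using TM[of p] p P M(4) by blast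
    qed
  qed
qed

text \<open>Forms are functions of a point and a list with real values. The pointwise structure
  makes their type a real vector space, so that \<open>open_cone_separation\<close> applies to sets
  of forms.\<close>

instantiation "fun" :: (type, real_vector) real_vector
begin

definition "scaleR r f = (\<lambda>x. r *\<^sub>R f x)"

instance
  by standard (auto simp: scaleR_fun_def algebra_simps)

end

section \<open>Calculus of smooth maps\<close>

text \<open>\<open>ksmooth k S f\<close> restricts \<open>smooth_on\<close> to derivatives of order at most \<open>k\<close>, which makes closure
  properties accessible to induction on \<open>k\<close>.\<close>

fun ksmooth :: "nat \<Rightarrow> 'e::euclidean_space set \<Rightarrow> ('e \<Rightarrow> 'f::real_normed_vector) \<Rightarrow> bool" where
  "ksmooth 0 S f \<longleftrightarrow> f differentiable_on S"
| "ksmooth (Suc k) S f \<longleftrightarrow>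
     f differentiable_on S \<and> (\<forall>v. ksmooth k S (\<lambda>x. frechet_derivative f (at x) v))"

lemma ksmooth_iff_iter_deriv:
  "ksmooth k S f \<longleftrightarrow> (\<forall>vs. length vs \<le> k \<longrightarrow> iter_deriv vs f differentiable_on S)"
proof (induction k arbitrary: f)
  case 0
  then show ?case by simp
next
  case (Suc k)
  have "(\<forall>vs. length vs \<le> Suc k \<longrightarrow> iter_deriv vs f differentiable_on S) \<longleftrightarrow>
    f differentiable_on S \<and>
    (\<forall>v vs. length vs \<le> k \<longrightarrow> iter_deriv (v # vs) f differentiable_on S)"
    by (metis (no_types, lifting) Suc_le_mono iter_deriv.simps(1) le0 length_Cons list.size(3) neq_Nil_conv)
  then show ?case by (simp add: Suc.IH)
qed

lemma smooth_on_iff_ksmooth: "smooth_on S f \<longleftrightarrow> open S \<and> (\<forall>k. ksmooth k S f)"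
  unfolding smooth_on_def ksmooth_iff_iter_deriv by auto

lemma ksmooth_SucD: "ksmooth (Suc k) S f \<Longrightarrow> ksmooth k S f"
  by (auto simp: ksmooth_iff_iter_deriv)

lemma differentiable_on_open_at:
  "f differentiable_on S \<Longrightarrow> open S \<Longrightarrow> x \<in> S \<Longrightarrow> f differentiable (at x)"
  by (simp add: differentiable_on_eq_differentiable_at)

lemma ksmooth_mono: "ksmooth k S f \<Longrightarrow> T \<subseteq> S \<Longrightarrow> ksmooth k T f"
  by (induction k arbitrary: f) (auto intro: differentiable_on_subset)

lemma differentiable_on_cong_open:
  assumes "open S" "\<And>x. x \<in> S \<Longrightarrow> f x = g x" "f differentiable_on S"
  shows "g differentiable_on S"
  using assms has_derivative_transform[of _ S g f]
  by (auto simp: differentiable_on_def differentiable_def) metis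

text \<open>\<open>frechet_derivative\<close> looks at a full neighbourhood of the point; openness
  of \<open>S\<close> is what lets agreement on \<open>S\<close> pass to the derivatives.\<close>

lemma ksmooth_cong:
  assumes "open S" "\<And>x. x \<in> S \<Longrightarrow> f x = g x" "ksmooth k S f"
  shows "ksmooth k S g"
  using assms(2,3)
proof (induction k arbitrary: f g)
  case 0
  then show ?case using differentiable_on_cong_open[OF assms(1), of f g] by simp
next
  case (Suc k)
  have "f differentiable_on S" using Suc.prems by simp
  moreover have "ksmooth k S (\<lambda>x. frechet_derivative g (at x) v)" for v
  proof (rule Suc.IH)
    show "ksmooth k S (\<lambda>x. frechet_derivative f (at x) v)" using Suc.prems by simp
    fix x assume "x \<in> S"
    then show "frechet_derivative f (at x) v = frechet_derivative g (at x) v"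
      using frechet_derivative_transform_within_open[of f x S g] Suc.prems
        differentiable_on_open_at[OF \<open>f differentiable_on S\<close> assms(1)] assms(1) by metis
  qed
  ultimately show ?case using Suc.prems differentiable_on_cong_open[OF assms(1), of f g] by simp
qed

text \<open>The induction step in usable form: any explicit formula for the derivative may stand in
  for \<open>frechet_derivative\<close>.\<close>

lemma ksmooth_derivI:
  assumes "open S" "\<And>x. x \<in> S \<Longrightarrow> (f has_derivative f' x) (at x)"
    "\<And>v. ksmooth k S (\<lambda>x. f' x v)"
  shows "ksmooth (Suc k) S f"
proof -
  have "f differentiable_on S"
    using assms(1,2) by (auto simp: differentiable_on_eq_differentiable_at differentiable_def)
  moreover have "ksmooth k S (\<lambda>x. frechet_derivative f (at x) v)" for v
    by (rule ksmooth_cong[OF assms(1) _ assms(3)[of v]])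
      (metis assms(2) frechet_derivative_at)
  ultimately show ?thesis by simp
qed

lemma has_derivative_frechet:
  "f differentiable_on S \<Longrightarrow> open S \<Longrightarrow> x \<in> S \<Longrightarrow>
    (f has_derivative frechet_derivative f (at x)) (at x)"
  by (simp add: differentiable_on_open_at frechet_derivative_works[symmetric])

lemma ksmooth_const: "ksmooth k S (\<lambda>x. c)"
  by (induction k arbitrary: c) auto

lemma ksmooth_add:
  assumes "open S" "ksmooth k S f" "ksmooth k S g"
  shows "ksmooth k S (\<lambda>x. f x + g x)"
  using assms(2,3)
proof (induction k arbitrary: f g)
  case 0
  then show ?case by (simp add: differentiable_on_add)
next
  case (Suc k)
  show ?case
    by (rule ksmooth_derivI[OF assms(1) has_derivative_add[OF has_derivative_frechet has_derivative_frechet]])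
      (use Suc assms(1) in auto)
qed

lemma ksmooth_sum:
  assumes "open S" "\<And>i. i \<in> I \<Longrightarrow> ksmooth k S (f i)"
  shows "ksmooth k S (\<lambda>x. \<Sum>i\<in>I. f i x)"
  using assms(2)
proof (induction I rule: infinite_finite_induct)
  case (insert i I)
  have "ksmooth k S (\<lambda>x. f i x + (\<Sum>i\<in>I. f i x))"
    by (intro ksmooth_add[OF assms(1)] insert) auto
  then show ?case using insert by simp
qed (simp_all add: ksmooth_const)

lemma ksmooth_linear:
  assumes "bounded_linear L" "open S"
  shows "ksmooth k S L"
proof (cases k)
  case 0
  then show ?thesis
    using assms by (simp add: bounded_linear_imp_differentiable_on)
next
  case (Suc n)
  show ?thesis unfolding Suc
    by (rule ksmooth_derivI[OF assms(2) bounded_linear_imp_has_derivative[OF assms(1)]])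
      (rule ksmooth_const)
qed

text \<open>By the Leibniz rule the derivative is a sum of two products of the same kind. One
  induction thus serves real multiplication, scaling and the inner product.\<close>

lemma (in bounded_bilinear) ksmooth_prod:
  assumes "open S" "ksmooth k S f" "ksmooth k S g"
  shows "ksmooth k S (\<lambda>x. prod (f x) (g x))"
  using assms(2,3)
proof (induction k arbitrary: f g)
  case 0
  then show ?case
    unfolding differentiable_on_def differentiable_def ksmooth.simps using FDERIV by blast
next
  case (Suc k)
  have df: "f differentiable_on S" and dg: "g differentiable_on S" using Suc.prems by auto
  have "ksmooth k S (\<lambda>x. prod (f x) (frechet_derivative g (at x) v) +
      prod (frechet_derivative f (at x) v) (g x))" for v
    using Suc.prems ksmooth_SucD[OF Suc.prems(1)] ksmooth_SucD[OF Suc.prems(2)]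
    by (intro ksmooth_add[OF assms(1)] Suc.IH) auto
  then show ?case
    by (intro ksmooth_derivI[OF assms(1) FDERIV[OF has_derivative_frechet[OF df assms(1)]
      has_derivative_frechet[OF dg assms(1)]]])
qed

lemma ksmooth_compose:
  fixes f :: "'f::euclidean_space \<Rightarrow> 'g::real_normed_vector" and g :: "'e::euclidean_space \<Rightarrow> 'f"
  assumes "open S" "open T" "g ` S \<subseteq> T" "ksmooth k T f" "ksmooth k S g"
  shows "ksmooth k S (\<lambda>x. f (g x))"
  using assms(4,5)
proof (induction k arbitrary: f)
  case 0
  then show ?case
    using assms(1-3) differentiable_chain_at[of g _ f]
    by (auto simp: differentiable_on_eq_differentiable_at image_subset_iff o_def)
next
  case (Suc k)
  have df: "f differentiable_on T" and dg: "g differentiable_on S" using Suc.prems by auto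
  have Df: "(f has_derivative frechet_derivative f (at (g x))) (at (g x))" if "x \<in> S" for x
    using that assms has_derivative_frechet[OF df] by blast
  have 1: "((\<lambda>x. f (g x)) has_derivative
      (\<lambda>v. frechet_derivative f (at (g x)) (frechet_derivative g (at x) v))) (at x)" if "x \<in> S" for x
    using has_derivative_compose[OF has_derivative_frechet[OF dg assms(1) that] Df[OF that]] .
  show ?case
  proof (rule ksmooth_derivI[OF assms(1) 1])
    fix v
    \<comment> \<open>In the chain rule both the linear map and its argument vary with x. Expanding
      the argument in the basis leaves products of a scalar function with a partial derivative of
      \<open>f\<close> composed with \<open>g\<close>, and the induction hypothesis covers that
      composition.\<close>
    have k: "ksmooth k S (\<lambda>x. \<Sum>b\<in>Basis. (frechet_derivative g (at x) v \<bullet> b) *\<^sub>R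
        frechet_derivative f (at (g x)) b)"
      using Suc.prems ksmooth_SucD[OF Suc.prems(2)]
      by (intro ksmooth_sum assms(1) bounded_bilinear.ksmooth_prod[OF bounded_bilinear_scaleR]
        bounded_bilinear.ksmooth_prod[OF bounded_bilinear_inner] ksmooth_const Suc.IH) auto
    show "ksmooth k S (\<lambda>x. frechet_derivative f (at (g x)) (frechet_derivative g (at x) v))"
    proof (rule ksmooth_cong[OF assms(1) _ k])
      fix x assume "x \<in> S"
      interpret linear "frechet_derivative f (at (g x))"
        using Df[OF \<open>x \<in> S\<close>] has_derivative_linear by blast
      show "(\<Sum>b\<in>Basis. (frechet_derivative g (at x) v \<bullet> b) *\<^sub>R frechet_derivative f (at (g x)) b)
        = frechet_derivative f (at (g x)) (frechet_derivative g (at x) v)"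
        by (subst (3) euclidean_representation[symmetric]) (simp add: sum scale)
    qed
  qed auto
qed

lemma ksmooth_local:
  assumes "\<And>x. x \<in> S \<Longrightarrow> \<exists>U. open U \<and> x \<in> U \<and> ksmooth k U f"
  shows "ksmooth k S f"
  using assms
proof (induction k arbitrary: f)
  case 0
  have "f differentiable (at x)" if x: "x \<in> S" for x
    using 0[OF x] differentiable_on_open_at[of f _ x] by auto
  then show ?case by (simp add: differentiable_at_imp_differentiable_on)
next
  case (Suc k)
  have "f differentiable (at x)" if x: "x \<in> S" for x
    using Suc.prems[OF x] differentiable_on_open_at[of f _ x] by auto
  then have "f differentiable_on S" by (simp add: differentiable_at_imp_differentiable_on)
  moreover have "ksmooth k S (\<lambda>x. frechet_derivative f (at x) v)" for v
    using Suc.prems by (intro Suc.IH) fastforce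
  ultimately show ?case by simp
qed

lemma smooth_on_open: "smooth_on S f \<Longrightarrow> open S"
  by (simp add: smooth_on_def)

lemma smooth_on_differentiable: "smooth_on S f \<Longrightarrow> x \<in> S \<Longrightarrow> f differentiable (at x)"
  unfolding smooth_on_iff_ksmooth using differentiable_on_open_at ksmooth.simps(1) by blast

lemma smooth_on_has_derivative:
  "smooth_on S f \<Longrightarrow> x \<in> S \<Longrightarrow> (f has_derivative frechet_derivative f (at x)) (at x)"
  using smooth_on_differentiable frechet_derivative_works by blast

lemma smooth_on_continuous_on: "smooth_on S f \<Longrightarrow> continuous_on S f"
  by (metis differentiable_imp_continuous_on iter_deriv.simps(1) smooth_on_def)

lemma smooth_on_deriv: "smooth_on S f \<Longrightarrow> smooth_on S (\<lambda>x. frechet_derivative f (at x) v)"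
  unfolding smooth_on_iff_ksmooth by (metis ksmooth.simps(2))

lemma smooth_on_subset: "smooth_on S f \<Longrightarrow> T \<subseteq> S \<Longrightarrow> open T \<Longrightarrow> smooth_on T f"
  unfolding smooth_on_iff_ksmooth using ksmooth_mono by blast

lemma smooth_on_cong:
  "smooth_on S f \<Longrightarrow> (\<And>x. x \<in> S \<Longrightarrow> f x = g x) \<Longrightarrow> smooth_on S g"
  unfolding smooth_on_iff_ksmooth using ksmooth_cong by blast

text \<open>Needed for \<open>bump_form_smooth\<close>, where the formula for the coefficients
  changes from region to region.\<close>

lemma smooth_on_local:
  assumes "\<And>x. x \<in> S \<Longrightarrow> \<exists>U. x \<in> U \<and> smooth_on U f" "open S"
  shows "smooth_on S f"
proof -
  have "\<exists>U. open U \<and> x \<in> U \<and> ksmooth k U f" if "x \<in> S" for x k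
    using assms(1)[OF that] by (auto simp: smooth_on_iff_ksmooth)
  then have "ksmooth k S f" for k by (rule ksmooth_local)
  then show ?thesis using assms(2) by (simp add: smooth_on_iff_ksmooth)
qed

lemma smooth_on_const: "open S \<Longrightarrow> smooth_on S (\<lambda>x. c)"
  by (simp add: smooth_on_iff_ksmooth ksmooth_const)

lemma smooth_on_linear: "bounded_linear L \<Longrightarrow> open S \<Longrightarrow> smooth_on S L"
  by (simp add: smooth_on_iff_ksmooth ksmooth_linear)

lemma smooth_on_add: "smooth_on S f \<Longrightarrow> smooth_on S g \<Longrightarrow> smooth_on S (\<lambda>x. f x + g x)"
  by (simp add: smooth_on_iff_ksmooth ksmooth_add)

lemma smooth_on_sum:
  "open S \<Longrightarrow> (\<And>i. i \<in> I \<Longrightarrow> smooth_on S (f i)) \<Longrightarrow> smooth_on S (\<lambda>x. \<Sum>i\<in>I. f i x)"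
  by (simp add: smooth_on_iff_ksmooth ksmooth_sum)

lemma smooth_on_mult:
  fixes f g :: "'e::euclidean_space \<Rightarrow> real"
  shows "smooth_on S f \<Longrightarrow> smooth_on S g \<Longrightarrow> smooth_on S (\<lambda>x. f x * g x)"
  by (simp add: smooth_on_iff_ksmooth bounded_bilinear.ksmooth_prod[OF bounded_bilinear_mult])

lemma smooth_on_scaleR:
  "smooth_on S f \<Longrightarrow> smooth_on S g \<Longrightarrow> smooth_on S (\<lambda>x. f x *\<^sub>R g x)"
  by (simp add: smooth_on_iff_ksmooth bounded_bilinear.ksmooth_prod[OF bounded_bilinear_scaleR])

lemma smooth_on_inner:
  fixes f g :: "'e::euclidean_space \<Rightarrow> 'f::real_inner"
  shows "smooth_on S f \<Longrightarrow> smooth_on S g \<Longrightarrow> smooth_on S (\<lambda>x. f x \<bullet> g x)"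
  by (simp add: smooth_on_iff_ksmooth bounded_bilinear.ksmooth_prod[OF bounded_bilinear_inner])

lemma smooth_on_diff:
  assumes "smooth_on S f" "smooth_on S g" shows "smooth_on S (\<lambda>x. f x - g x)"
  using smooth_on_add[OF assms(1) smooth_on_scaleR[OF smooth_on_const assms(2), of "-1"]]
    smooth_on_open[OF assms(1)] by simp

lemma smooth_on_compose:
  fixes f :: "'f::euclidean_space \<Rightarrow> 'g::real_normed_vector" and g :: "'e::euclidean_space \<Rightarrow> 'f"
  shows "smooth_on T f \<Longrightarrow> smooth_on S g \<Longrightarrow> g ` S \<subseteq> T \<Longrightarrow> smooth_on S (\<lambda>x. f (g x))"
  by (auto simp: smooth_on_iff_ksmooth intro: ksmooth_compose)

section \<open>Symmetry of second derivatives\<close>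

lemma frechet_derivative_apply_linear:
  assumes "bounded_linear L" "g differentiable (at x)"
  shows "frechet_derivative (\<lambda>y. L (g y)) (at x) v = L (frechet_derivative g (at x) v)"
  using bounded_linear.has_derivative[OF assms(1) frechet_derivative_works[THEN iffD1, OF assms(2)]]
  by (metis frechet_derivative_at)

text \<open>The mean value theorem is applied twice: along \<open>u\<close> to the increment of
  \<open>f\<close> in direction \<open>v\<close>, and along \<open>v\<close> to the derivative of
  \<open>f\<close> in direction \<open>u\<close>. The left-hand side is symmetric in
  \<open>u\<close> and \<open>v\<close>, the right-hand side is not visibly so.\<close>

lemma second_difference_mvt:
  fixes f :: "'e::euclidean_space \<Rightarrow> real"
  assumes f: "smooth_on S f" and h: "h > 0"
    and S: "\<And>s t. 0 \<le> s \<Longrightarrow> s \<le> h \<Longrightarrow> 0 \<le> t \<Longrightarrow> t \<le> h \<Longrightarrow> x + s *\<^sub>R u + t *\<^sub>R v \<in> S"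
  shows "\<exists>s t. 0 \<le> s \<and> s \<le> h \<and> 0 \<le> t \<and> t \<le> h \<and>
    f (x + h *\<^sub>R u + h *\<^sub>R v) - f (x + h *\<^sub>R u) - (f (x + h *\<^sub>R v) - f x) =
    h * (h * frechet_derivative (\<lambda>y. frechet_derivative f (at y) u) (at (x + s *\<^sub>R u + t *\<^sub>R v)) v)"
proof -
  have D: "((\<lambda>s. g (a + s *\<^sub>R w)) has_real_derivative frechet_derivative g (at (a + s *\<^sub>R w)) w) (at s)"
    if "smooth_on S g" "a + s *\<^sub>R w \<in> S" for g :: "'e \<Rightarrow> real" and a w s
  proof -
    have g: "(g has_derivative frechet_derivative g (at (a + s *\<^sub>R w))) (at (a + s *\<^sub>R w))"
      using smooth_on_has_derivative that by blast
    have "((\<lambda>s. a + s *\<^sub>R w) has_derivative (\<lambda>r. r *\<^sub>R w)) (at s)"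
      by (auto intro!: derivative_eq_intros)
    from has_derivative_compose[OF this g] show ?thesis
      using linear_scale[OF has_derivative_linear[OF g]]
      by (simp add: has_field_derivative_def mult_commute_abs)
  qed
  let ?fu = "\<lambda>y. frechet_derivative f (at y) u"
  have "\<exists>s>0. s < h \<and> (f ((x + h *\<^sub>R v) + h *\<^sub>R u) - f (x + h *\<^sub>R u)) - (f ((x + h *\<^sub>R v) + 0 *\<^sub>R u) - f (x + 0 *\<^sub>R u))
      = (h - 0) * (?fu ((x + h *\<^sub>R v) + s *\<^sub>R u) - ?fu (x + s *\<^sub>R u))"
    using S[of _ h] S[of _ 0] h
    by (intro MVT2 DERIV_diff D f) (auto simp: algebra_simps)
  then obtain s where s: "0 < s" "s < h" and seq: "f (x + h *\<^sub>R u + h *\<^sub>R v) - f (x + h *\<^sub>R u) - (f (x + h *\<^sub>R v) - f x)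
    = h * (?fu (x + s *\<^sub>R u + h *\<^sub>R v) - ?fu (x + s *\<^sub>R u))"
    by (auto simp: algebra_simps)
  have "\<exists>t>0. t < h \<and> ?fu (x + s *\<^sub>R u + h *\<^sub>R v) - ?fu (x + s *\<^sub>R u + 0 *\<^sub>R v)
     = (h - 0) * frechet_derivative ?fu (at (x + s *\<^sub>R u + t *\<^sub>R v)) v"
    using S s h by (intro MVT2 D smooth_on_deriv f) auto
  then obtain t where t: "0 < t" "t < h" "?fu (x + s *\<^sub>R u + h *\<^sub>R v) - ?fu (x + s *\<^sub>R u)
     = h * frechet_derivative ?fu (at (x + s *\<^sub>R u + t *\<^sub>R v)) v" by auto
  show ?thesis
    unfolding seq t(3) using s t by (intro exI[of _ s] exI[of _ t]) auto
qed

text \<open>Both mixed derivatives are continuous. If they differed at \<open>x\<close> by 2e, their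
  values near \<open>x\<close> would stay within e of the values at \<open>x\<close> and could never
  meet, but the second difference forces them to meet.\<close>

lemma second_derivative_symmetric_real:
  fixes f :: "'e::euclidean_space \<Rightarrow> real"
  assumes f: "smooth_on S f" and x: "x \<in> S"
  shows "frechet_derivative (\<lambda>y. frechet_derivative f (at y) u) (at x) v =
    frechet_derivative (\<lambda>y. frechet_derivative f (at y) v) (at x) u"
proof (rule ccontr)
  define D where "D u v y = frechet_derivative (\<lambda>y. frechet_derivative f (at y) u) (at y) v" for u v y
  assume "\<not> ?thesis"
  then have ne: "D u v x \<noteq> D v u x" by (simp add: D_def)
  define e where "e = \<bar>D u v x - D v u x\<bar> / 2"
  have e: "e > 0" using ne by (simp add: e_def)
  have cont: "isCont (D u v) x" for u v
    using smooth_on_continuous_on[OF smooth_on_deriv[OF smooth_on_deriv[OF f]]] x smooth_on_open[OF f]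
    unfolding D_def by (simp add: continuous_on_eq_continuous_at)
  obtain d1 where d1: "d1 > 0" "\<And>y. dist y x < d1 \<Longrightarrow> dist (D u v y) (D u v x) < e"
    using cont[of u v] e unfolding continuous_at_eps_delta by blast
  obtain d2 where d2: "d2 > 0" "\<And>y. dist y x < d2 \<Longrightarrow> dist (D v u y) (D v u x) < e"
    using cont[of v u] e unfolding continuous_at_eps_delta by blast
  obtain d3 where d3: "d3 > 0" "\<And>y. dist y x < d3 \<Longrightarrow> y \<in> S"
    using smooth_on_open[OF f] x unfolding open_dist by blast
  define d where "d = min d1 (min d2 d3)"
  \<comment> \<open>With this \<open>h\<close> the parallelogram spanned by
    \<open>h *\<^sub>R u\<close> and \<open>h *\<^sub>R v\<close> at \<open>x\<close> stays within
    distance d; the summand 1 keeps the denominator positive when both vectors vanish.\<close>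
  define h where "h = d / (norm u + norm v + 1)"
  have dpos: "d > 0" using d1 d2 d3 by (simp add: d_def)
  have hpos: "h > 0" using dpos by (simp add: h_def add_nonneg_pos)
  have near: "dist (x + s *\<^sub>R u + t *\<^sub>R v) x < d" if "0 \<le> s" "s \<le> h" "0 \<le> t" "t \<le> h" for s t
  proof -
    have "dist (x + s *\<^sub>R u + t *\<^sub>R v) x = norm (s *\<^sub>R u + t *\<^sub>R v)" by (simp add: dist_norm)
    also have "\<dots> \<le> s * norm u + t * norm v"
      using norm_triangle_ineq[of "s *\<^sub>R u" "t *\<^sub>R v"] that by simp
    also have "\<dots> \<le> h * norm u + h * norm v"
      using that by (intro add_mono mult_right_mono) auto
    also have "\<dots> < h * (norm u + norm v + 1)" using hpos by (simp add: algebra_simps)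
    also have "\<dots> = d" unfolding h_def
      by (metis add_nonneg_pos norm_ge_zero add_nonneg_nonneg less_numeral_extra(1) nonzero_eq_divide_eq order_less_irrefl)
    finally show ?thesis .
  qed
  have near': "dist (x + s *\<^sub>R v + t *\<^sub>R u) x < d" if "0 \<le> s" "s \<le> h" "0 \<le> t" "t \<le> h" for s t
    using near[of t s] that by (simp add: add_ac)
  let ?\<Delta> = "f (x + h *\<^sub>R u + h *\<^sub>R v) - f (x + h *\<^sub>R u) - (f (x + h *\<^sub>R v) - f x)"
  obtain s t where st: "0 \<le> s" "s \<le> h" "0 \<le> t" "t \<le> h" "?\<Delta> = h * (h * D u v (x + s *\<^sub>R u + t *\<^sub>R v))"
    using second_difference_mvt[OF f hpos, of x u v] near d3 unfolding D_def d_def by fastforce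
  obtain s' t' where st': "0 \<le> s'" "s' \<le> h" "0 \<le> t'" "t' \<le> h"
      "f (x + h *\<^sub>R v + h *\<^sub>R u) - f (x + h *\<^sub>R v) - (f (x + h *\<^sub>R u) - f x)
       = h * (h * D v u (x + s' *\<^sub>R v + t' *\<^sub>R u))"
    using second_difference_mvt[OF f hpos, of x v u] near' d3 unfolding D_def d_def by fastforce
  \<comment> \<open>Swapping \<open>u\<close> and \<open>v\<close> leaves the second difference
    unchanged, so one mixed derivative at one nearby point equals the other at another nearby
    point.\<close>
  have "?\<Delta> = h * (h * D v u (x + s' *\<^sub>R v + t' *\<^sub>R u))"
    unfolding st'(5)[symmetric] by (simp add: add_ac)
  then have "D u v (x + s *\<^sub>R u + t *\<^sub>R v) = D v u (x + s' *\<^sub>R v + t' *\<^sub>R u)"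
    using st(5) hpos by simp
  moreover have "dist (D u v (x + s *\<^sub>R u + t *\<^sub>R v)) (D u v x) < e"
    using near[OF st(1-4)] by (intro d1) (simp add: d_def)
  moreover have "dist (D v u (x + s' *\<^sub>R v + t' *\<^sub>R u)) (D v u x) < e"
    using near'[OF st'(1-4)] by (intro d2) (simp add: d_def)
  ultimately have "\<bar>D u v x - D v u x\<bar> < 2 * e" by (simp add: dist_real_def)
  then show False by (simp add: e_def)
qed

text \<open>Applied componentwise, since transition maps are vector-valued.\<close>

lemma second_derivative_symmetric:
  fixes f :: "'e::euclidean_space \<Rightarrow> 'f::euclidean_space"
  assumes f: "smooth_on S f" and x: "x \<in> S"
  shows "frechet_derivative (\<lambda>y. frechet_derivative f (at y) u) (at x) v =
    frechet_derivative (\<lambda>y. frechet_derivative f (at y) v) (at x) u"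
proof (rule euclidean_eqI)
  fix b :: 'f assume "b \<in> Basis"
  let ?g = "\<lambda>y. f y \<bullet> b"
  have L: "bounded_linear (\<lambda>y::'f. y \<bullet> b)" by (rule bounded_linear_inner_left)
  have g: "smooth_on S ?g"
    using smooth_on_compose[OF smooth_on_linear[OF L open_UNIV] f] by simp
  have 1: "frechet_derivative ?g (at y) w = frechet_derivative f (at y) w \<bullet> b" if "y \<in> S" for y w
    using frechet_derivative_apply_linear[OF L smooth_on_differentiable[OF f that]] .
  have 2: "frechet_derivative (\<lambda>y. frechet_derivative ?g (at y) u) (at x) v =
    frechet_derivative (\<lambda>y. frechet_derivative f (at y) u) (at x) v \<bullet> b" for u v
  proof -
    have "frechet_derivative (\<lambda>y. frechet_derivative ?g (at y) u) (at x) =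
      frechet_derivative (\<lambda>y. frechet_derivative f (at y) u \<bullet> b) (at x)"
      by (rule frechet_derivative_transform_within_open[OF
        smooth_on_differentiable[OF smooth_on_deriv[OF g] x] smooth_on_open[OF f] x 1])
    then show ?thesis
      using frechet_derivative_apply_linear[OF L smooth_on_differentiable[OF smooth_on_deriv[OF f] x]]
      by simp
  qed
  show "frechet_derivative (\<lambda>y. frechet_derivative f (at y) u) (at x) v \<bullet> b =
    frechet_derivative (\<lambda>y. frechet_derivative f (at y) v) (at x) u \<bullet> b"
    using second_derivative_symmetric_real[OF g x, of u v] unfolding 2 .
qed

section \<open>Bump functions\<close>

text \<open>The functions \<open>flat n\<close> are smooth because the derivative of \<open>flat n\<close> is
  \<open>flat (n + 2) - n * flat (n + 1)\<close>.\<close>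

definition flat :: "nat \<Rightarrow> real \<Rightarrow> real" where
  "flat n t = (if t > 0 then inverse t ^ n / exp (inverse t) else 0)"

text \<open>From the right, substituting 1/t reduces the claim to the decay of x^n / exp x at
  infinity.\<close>

lemma flat_tendsto_0: "(flat n \<longlongrightarrow> 0) (at 0)"
proof -
  have "((\<lambda>t. inverse t ^ n / exp (inverse t)) \<longlongrightarrow> 0) (at_right (0::real))"
    by (rule filterlim_compose[OF tendsto_power_div_exp_0 filterlim_inverse_at_top_right])
  then have "(flat n \<longlongrightarrow> 0) (at_right 0)"
    by (rule Lim_transform_eventually)
      (auto simp: flat_def eventually_at_filter intro!: always_eventually)
  moreover have "(flat n \<longlongrightarrow> 0) (at_left 0)"
    by (rule Lim_transform_eventually[OF tendsto_const])
      (auto simp: flat_def eventually_at_filter intro!: always_eventually)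
  ultimately show ?thesis by (simp add: filterlim_split_at)
qed

lemma flat_has_derivative:
  "(flat n has_real_derivative flat (n + 2) t - real n * flat (n + 1) t) (at t)"
proof -
  consider "t > 0" | "t = 0" | "t < 0" by linarith
  then show ?thesis
  proof cases
    case 1
    have "((\<lambda>t. inverse t ^ n / exp (inverse t)) has_real_derivative
        flat (n + 2) t - real n * flat (n + 1) t) (at t)"
    proof (cases n)
      case 0
      then show ?thesis using 1
        by (auto intro!: derivative_eq_intros simp: flat_def field_simps power2_eq_square)
    next
      case (Suc m)
      then show ?thesis using 1
        by (auto intro!: derivative_eq_intros
            simp: flat_def field_simps power2_eq_square simp del: power_Suc) (simp add: field_simps)
    qed
    then show ?thesis
      by (rule has_field_derivative_transform_within_open[where S="{0<..}"])
        (use 1 in \<open>auto simp: flat_def\<close>)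
  next
    case 2
    \<comment> \<open>The difference quotient of \<open>flat n\<close> at 0 is
      \<open>flat (n + 1)\<close>, so the derivative there is again the limit from
      \<open>flat_tendsto_0\<close>.\<close>
    have "((\<lambda>h. (flat n (0 + h) - flat n 0) / h) \<longlongrightarrow> 0) (at 0)"
      by (rule Lim_transform_eventually[OF flat_tendsto_0[of "n + 1"]])
        (auto simp: flat_def eventually_at_filter field_simps intro!: always_eventually)
    then show ?thesis by (simp add: 2 DERIV_def flat_def)
  next
    case 3
    show ?thesis
      by (rule has_field_derivative_transform_within_open[where S="{..<0}" and f="\<lambda>t. 0"])
        (use 3 in \<open>auto simp: flat_def\<close>)
  qed
qed

lemma smooth_on_flat: "smooth_on UNIV (flat n)"
proof -
  have "ksmooth k UNIV (flat n)" for k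
  proof (induction k arbitrary: n)
    case 0
    show ?case using flat_has_derivative[of n]
      by (auto simp: differentiable_on_def differentiable_def has_field_derivative_def
          intro: has_derivative_at_withinI)
  next
    case (Suc k)
    show ?case
    proof (rule ksmooth_derivI[OF open_UNIV])
      show "(flat n has_derivative (\<lambda>v. (flat (n + 2) t - real n * flat (n + 1) t) * v)) (at t)" for t
        using flat_has_derivative[of n t] by (simp add: has_field_derivative_def)
      fix v
      have "ksmooth k UNIV (\<lambda>t. flat (n + 2) t * v + (- real n * v) * flat (n + 1) t)"
        by (intro ksmooth_add bounded_bilinear.ksmooth_prod[OF bounded_bilinear_mult]
            ksmooth_const Suc.IH open_UNIV)
      then show "ksmooth k UNIV (\<lambda>t. (flat (n + 2) t - real n * flat (n + 1) t) * v)"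
        by (simp add: algebra_simps)
    qed
  qed
  then show ?thesis by (simp add: smooth_on_iff_ksmooth)
qed

text \<open>The function is exp(-1/q) with q = r^2 - |x - x0|^2, continued by 0 to where q is not
  positive; q is positive exactly on the ball.\<close>

lemma bump_function_exists:
  fixes x0 :: "'e::euclidean_space"
  assumes "r > 0"
  shows "\<exists>h::'e \<Rightarrow> real. smooth_on UNIV h \<and> (\<forall>x. h x \<ge> 0) \<and>
    (\<forall>x. h x > 0 \<longleftrightarrow> x \<in> ball x0 r)"
proof -
  have pos: "flat 0 t \<ge> 0 \<and> (flat 0 t > 0 \<longleftrightarrow> t > 0)" for t by (simp add: flat_def)
  let ?q = "\<lambda>x::'e. r\<^sup>2 - (x - x0) \<bullet> (x - x0)"
  have id: "smooth_on UNIV (\<lambda>x::'e. x)" using smooth_on_linear[OF bounded_linear_ident open_UNIV] .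
  have "smooth_on UNIV (\<lambda>x. flat 0 (?q x))"
    by (rule smooth_on_compose[OF smooth_on_flat])
      (intro smooth_on_diff smooth_on_inner smooth_on_const id open_UNIV, simp)
  moreover have "?q x > 0 \<longleftrightarrow> x \<in> ball x0 r" for x
    using assms abs_less_iff norm_lt_square[of "x - x0" r]
    by (auto simp: dist_norm norm_minus_commute power2_eq_square)
  ultimately show ?thesis using pos by (intro exI[of _ "\<lambda>x. flat 0 (?q x)"]) auto
qed

section \<open>Charts, tangent vectors and local representatives\<close>

locale closed_atlas =
  fixes X :: "'a topology" and A :: "('a, 'e::euclidean_space) chart set"
  assumes closed_mfd: "closed_manifold X A"
begin

lemma Hausdorff: "Hausdorff_space X" and compact_X: "compact_space X"
  and is_chart: "c \<in> A \<Longrightarrow> is_chart X c"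
  and cover: "(\<Union>c\<in>A. fst c) = topspace X"
  and smooth_transition: "c \<in> A \<Longrightarrow> c' \<in> A \<Longrightarrow>
    smooth_on (snd c ` (fst c \<inter> fst c')) (transition c c')"
  using closed_mfd by (auto simp: closed_manifold_def smooth_manifold_def smooth_atlas_def)

section \<open>Charts as homeomorphisms onto open sets\<close>

lemma openin_chart: "c \<in> A \<Longrightarrow> openin X (fst c)"
  and open_image_chart: "c \<in> A \<Longrightarrow> open (snd c ` fst c)"
  and homeo_chart: "c \<in> A \<Longrightarrow>
    homeomorphic_map (subtopology X (fst c)) (top_of_set (snd c ` fst c)) (snd c)"
  using is_chart by (auto simp: is_chart_def)

lemma chart_subset: "c \<in> A \<Longrightarrow> fst c \<subseteq> topspace X"
  using openin_chart openin_subset by blast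

lemma topspace_chart: "c \<in> A \<Longrightarrow> topspace (subtopology X (fst c)) = fst c"
  using chart_subset[of c] by auto

lemma inj_chart: "c \<in> A \<Longrightarrow> inj_on (snd c) (fst c)"
  using homeomorphic_imp_injective_map[OF homeo_chart] topspace_chart by metis

lemma chart_inv_left [simp]: "c \<in> A \<Longrightarrow> p \<in> fst c \<Longrightarrow> chart_inv c (snd c p) = p"
  unfolding chart_inv_def using inj_chart by simp

lemma chart_inv_into: "x \<in> snd c ` fst c \<Longrightarrow> chart_inv c x \<in> fst c"
  and chart_inv_right [simp]: "x \<in> snd c ` fst c \<Longrightarrow> snd c (chart_inv c x) = x"
  unfolding chart_inv_def by (auto intro: inv_into_into f_inv_into_f)

lemma chart_inv_image: "B \<subseteq> snd c ` fst c \<Longrightarrow> snd c ` chart_inv c ` B = B"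
  unfolding chart_inv_def by (rule image_inv_into_cancel[OF refl])

lemma open_chart_image:
  assumes "c \<in> A" "openin X U"
  shows "open (snd c ` (fst c \<inter> U))"
proof -
  have "openin (subtopology X (fst c)) (fst c \<inter> U)"
    using assms openin_chart by (simp add: openin_open_subtopology openin_Int)
  then have "openin (top_of_set (snd c ` fst c)) (snd c ` (fst c \<inter> U))"
    using homeomorphic_map_openness[OF homeo_chart[OF assms(1)], of "fst c \<inter> U"]
    unfolding topspace_chart[OF assms(1)] by blast
  then show ?thesis using open_image_chart[OF assms(1)] openin_open_trans by blast
qed

lemma openin_chart_inv_image:
  assumes "c \<in> A" "open B" "B \<subseteq> snd c ` fst c"
  shows "openin X (chart_inv c ` B)"
proof -
  have sub: "chart_inv c ` B \<subseteq> fst c" by (rule image_subsetI, rule chart_inv_into) (use assms(3) in auto)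
  have "openin (top_of_set (snd c ` fst c)) (snd c ` chart_inv c ` B)"
    unfolding chart_inv_image[OF assms(3)] using assms by (metis open_image_chart openin_open_eq)
  then have "openin (subtopology X (fst c)) (chart_inv c ` B)"
    using homeomorphic_map_openness[OF homeo_chart[OF assms(1)], of "chart_inv c ` B"]
    unfolding topspace_chart[OF assms(1)] using sub by blast
  then show ?thesis using openin_chart[OF assms(1)] openin_open_subtopology by blast
qed

lemma compactin_chart_inv_image:
  assumes "c \<in> A" "compact K" "K \<subseteq> snd c ` fst c"
  shows "compactin X (chart_inv c ` K)"
proof -
  have sub: "chart_inv c ` K \<subseteq> fst c" by (rule image_subsetI, rule chart_inv_into) (use assms(3) in auto)
  have "compactin (top_of_set (snd c ` fst c)) (snd c ` chart_inv c ` K)"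
    unfolding chart_inv_image[OF assms(3)] using assms by (metis compactin_euclidean_iff compactin_subtopology)
  then have "compactin (subtopology X (fst c)) (chart_inv c ` K)"
    using homeomorphic_map_compactness[OF homeo_chart[OF assms(1)], of "chart_inv c ` K"]
    unfolding topspace_chart[OF assms(1)] using sub by blast
  then show ?thesis by (simp add: compactin_subtopology)
qed

lemma charts_atD: "c \<in> charts_at A p \<Longrightarrow> c \<in> A \<and> p \<in> fst c \<and> p \<in> topspace X"
  using chart_subset[of c] by (auto simp: charts_at_def)

lemma charts_atI: "c \<in> A \<Longrightarrow> p \<in> fst c \<Longrightarrow> c \<in> charts_at A p"
  by (simp add: charts_at_def)

lemma charts_at_inv: "c \<in> A \<Longrightarrow> x \<in> snd c ` fst c \<Longrightarrow> c \<in> charts_at A (chart_inv c x)"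
  by (simp add: charts_at_def chart_inv_into)

lemma some_chart: "p \<in> topspace X \<Longrightarrow> (SOME c. c \<in> charts_at A p) \<in> charts_at A p"
  unfolding charts_at_def cover[symmetric] by (rule someI_ex) auto

section \<open>Coordinate changes and tangent vectors\<close>

lemma transition_apply [simp]:
  "c \<in> A \<Longrightarrow> p \<in> fst c \<Longrightarrow> transition c c' (snd c p) = snd c' p"
  by (simp add: transition_def)

lemma transition_differentiable:
  "c \<in> charts_at A p \<Longrightarrow> c' \<in> charts_at A p \<Longrightarrow> transition c c' differentiable (at (snd c p))"
  by (rule smooth_on_differentiable[OF smooth_transition]) (auto dest: charts_atD)

abbreviation dtrans :: "('a, 'e) chart \<Rightarrow> ('a, 'e) chart \<Rightarrow> 'a \<Rightarrow> 'e \<Rightarrow> 'e" where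
  "dtrans c c' p \<equiv> frechet_derivative (transition c c') (at (snd c p))"

lemma dtrans_linear:
  "c \<in> charts_at A p \<Longrightarrow> c' \<in> charts_at A p \<Longrightarrow> linear (dtrans c c' p)"
  using transition_differentiable linear_frechet_derivative by blast

text \<open>\<open>transition c c\<close> is the identity on the image of the chart, which is open,
  and that determines the derivative.\<close>

lemma dtrans_same:
  assumes "c \<in> charts_at A p" shows "dtrans c c p e = e"
proof -
  have c: "c \<in> A" "p \<in> fst c" using charts_atD assms by auto
  have "frechet_derivative (\<lambda>x. x) (at (snd c p)) = dtrans c c p"
    by (rule frechet_derivative_transform_within_open[OF _ open_image_chart[OF c(1)]])
      (use c in auto)
  then show ?thesis by (metis frechet_derivative_ident)
qed

text \<open>The cocycle rule: the composite agrees with the direct coordinate change on the open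
  image of the overlap of \<open>c\<close> and \<open>c'\<close>.\<close>

lemma dtrans_chain:
  assumes "c \<in> charts_at A p" "c' \<in> charts_at A p" "c'' \<in> charts_at A p"
  shows "dtrans c' c'' p (dtrans c c' p e) = dtrans c c'' p e"
proof -
  have c: "c \<in> A" "p \<in> fst c" "c' \<in> A" "p \<in> fst c'" "c'' \<in> A" "p \<in> fst c''"
    using charts_atD assms by auto
  have "frechet_derivative (transition c' c'' \<circ> transition c c') (at (snd c p)) = dtrans c c'' p"
  proof (rule frechet_derivative_transform_within_open)
    show "transition c' c'' \<circ> transition c c' differentiable at (snd c p)"
      using transition_differentiable assms c by (intro differentiable_chain_at) auto
    show "open (snd c ` (fst c \<inter> fst c'))"
      using open_chart_image[OF c(1) openin_chart[OF c(3)]] .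
  qed (use c in \<open>auto\<close>)
  moreover have "frechet_derivative (transition c' c'' \<circ> transition c c') (at (snd c p)) =
    dtrans c' c'' p \<circ> dtrans c c' p"
    using frechet_derivative_compose[of "transition c c'" "snd c p" "transition c' c''"]
      transition_differentiable assms c by auto
  ultimately show ?thesis by (metis comp_apply)
qed

lemma coord_vector_apply:
  "c' \<in> charts_at A p \<Longrightarrow> coord_vector A c p e c' = dtrans c c' p e"
  by (simp add: coord_vector_def)

lemma coord_vector_same [simp]: "c \<in> charts_at A p \<Longrightarrow> coord_vector A c p e c = e"
  by (simp add: coord_vector_apply dtrans_same)

lemma coord_vector_tangent: "c \<in> charts_at A p \<Longrightarrow> coord_vector A c p e \<in> tangent_space A p"
  by (auto simp: tangent_space_def coord_vector_def dtrans_chain)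

lemma tangent_trans:
  "v \<in> tangent_space A p \<Longrightarrow> c \<in> charts_at A p \<Longrightarrow> c' \<in> charts_at A p \<Longrightarrow>
    v c' = dtrans c c' p (v c)"
  unfolding tangent_space_def by blast

lemma tangent_outside: "v \<in> tangent_space A p \<Longrightarrow> c \<notin> charts_at A p \<Longrightarrow> v c = 0"
  unfolding tangent_space_def by blast

text \<open>A tangent vector is recovered from its coordinates in one chart: the transformation law
  fixes the other charts around \<open>p\<close>, and the normalisation to 0 fixes the remaining
  ones.\<close>

lemma coord_vector_of_tangent:
  "c \<in> charts_at A p \<Longrightarrow> v \<in> tangent_space A p \<Longrightarrow> coord_vector A c p (v c) = v"
  unfolding coord_vector_def by (rule ext) (metis tangent_trans tangent_outside)

lemma coord_vector_trans:
  "c \<in> charts_at A p \<Longrightarrow> c' \<in> charts_at A p \<Longrightarrow>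
    coord_vector A c' p (dtrans c c' p e) = coord_vector A c p e"
  by (auto simp: coord_vector_def dtrans_chain)

lemma coord_vector_lincomb:
  assumes "c \<in> charts_at A p"
  shows "coord_vector A c p (a *\<^sub>R u + b *\<^sub>R v) =
    tangent_lincomb a (coord_vector A c p u) b (coord_vector A c p v)"
  using dtrans_linear[OF assms]
  by (auto simp: coord_vector_def tangent_lincomb_def linear_add linear_scale fun_eq_iff)

lemma tangent_lincomb_space:
  assumes "v \<in> tangent_space A p" "w \<in> tangent_space A p"
  shows "tangent_lincomb a v b w \<in> tangent_space A p"
  unfolding tangent_space_def tangent_lincomb_def mem_Collect_eq
proof (intro conjI allI impI ballI)
  fix c assume "c \<notin> charts_at A p"
  then show "a *\<^sub>R v c + b *\<^sub>R w c = 0"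
    using tangent_outside[OF assms(1)] tangent_outside[OF assms(2)] by simp
next
  fix c c' assume c: "c \<in> charts_at A p" "c' \<in> charts_at A p"
  show "a *\<^sub>R v c' + b *\<^sub>R w c' = dtrans c c' p (a *\<^sub>R v c + b *\<^sub>R w c)"
    using tangent_trans[OF assms(1) c] tangent_trans[OF assms(2) c] dtrans_linear[OF c]
    by (simp only: linear_add linear_scale)
qed

lemma coord_vector_tuple:
  "c \<in> charts_at A p \<Longrightarrow> map (coord_vector A c p) es \<in> tangent_tuples A (length es) p"
  using coord_vector_tangent[of c p] by (auto simp: tangent_tuples_def)

lemma local_rep_apply:
  "c \<in> A \<Longrightarrow> p \<in> fst c \<Longrightarrow> local_rep A c \<alpha> (snd c p) es = \<alpha> p (map (coord_vector A c p) es)"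
  by (simp add: local_rep_def)

lemma local_rep_trans:
  assumes "c \<in> charts_at A p" "c' \<in> charts_at A p"
  shows "local_rep A c \<alpha> (snd c p) es = local_rep A c' \<alpha> (snd c' p) (map (dtrans c c' p) es)"
  using charts_atD[OF assms(1)] charts_atD[OF assms(2)] coord_vector_trans[OF assms]
  by (simp add: local_rep_apply o_def)

lemma local_rep_form_lincomb:
  "local_rep A c (form_lincomb a \<alpha> b \<beta>) x es = a * local_rep A c \<alpha> x es + b * local_rep A c \<beta> x es"
  by (simp add: local_rep_def form_lincomb_def)

section \<open>Linearity of forms and of the exterior derivative\<close>

lemma smooth_local_rep:
  "\<alpha> \<in> smooth_forms X A k \<Longrightarrow> c \<in> A \<Longrightarrow> length es = k \<Longrightarrow>
    smooth_on (snd c ` fst c) (\<lambda>x. local_rep A c \<alpha> x es)"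
  by (simp add: smooth_forms_def)

lemma form_lincomb_smooth:
  assumes "\<alpha> \<in> smooth_forms X A k" "\<beta> \<in> smooth_forms X A k"
  shows "form_lincomb a \<alpha> b \<beta> \<in> smooth_forms X A k"
proof -
  have s: "smooth_on (snd c ` fst c) (\<lambda>x. local_rep A c (form_lincomb a \<alpha> b \<beta>) x es)"
    if "c \<in> A" "length es = k" for c es
    unfolding local_rep_form_lincomb
    using that assms by (intro smooth_on_add smooth_on_mult smooth_on_const smooth_local_rep
        open_image_chart) auto
  show ?thesis
    using assms s unfolding smooth_forms_def mem_Collect_eq
    by (intro conjI) (auto simp: form_lincomb_def algebra_simps)
qed

lemma zero_form_smooth: "(\<lambda>p vs. 0) \<in> smooth_forms X A k"
  using open_image_chart by (auto simp: smooth_forms_def local_rep_def intro: smooth_on_const)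

text \<open>A support is closed by construction, hence compact because \<open>X\<close> is. From
  here on, currents are functionals on all smooth forms.\<close>

lemma smooth_forms_compact: "compact_forms X A k = smooth_forms X A k"
  using closedin_compact_space[OF compact_X] closedin_closure_of
  by (auto simp: compact_forms_def form_support_def)

lemma smooth_form_lincomb_slot:
  assumes "\<alpha> \<in> smooth_forms X A k" "c \<in> A" "x \<in> snd c ` fst c" "length es = k" "i < k"
  shows "local_rep A c \<alpha> x (es[i := a *\<^sub>R u + b *\<^sub>R v]) =
    a * local_rep A c \<alpha> x (es[i := u]) + b * local_rep A c \<alpha> x (es[i := v])"
proof -
  let ?p = "chart_inv c x" and ?V = "\<lambda>e. coord_vector A c (chart_inv c x) e"
  have c: "c \<in> charts_at A ?p" using charts_at_inv assms by blast
  have "\<alpha> ?p ((map ?V es)[i := tangent_lincomb a (?V u) b (?V v)]) =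
      a * \<alpha> ?p ((map ?V es)[i := ?V u]) + b * \<alpha> ?p ((map ?V es)[i := ?V v])"
    using assms charts_atD[OF c] coord_vector_tuple[OF c, of es] coord_vector_tangent[OF c]
    by (auto simp: smooth_forms_def)
  then show ?thesis
    by (simp add: local_rep_def map_update coord_vector_lincomb[OF c])
qed

lemma linear_local_rep_slot:
  assumes "\<alpha> \<in> smooth_forms X A k" "c \<in> A" "x \<in> snd c ` fst c" "length es = k" "i < k"
  shows "linear (\<lambda>u. local_rep A c \<alpha> x (es[i := u]))"
proof (rule linearI)
  fix u v :: 'e and r :: real
  show "local_rep A c \<alpha> x (es[i := u + v]) =
      local_rep A c \<alpha> x (es[i := u]) + local_rep A c \<alpha> x (es[i := v])"
    using smooth_form_lincomb_slot[OF assms, of 1 u 1 v] by simp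
  show "local_rep A c \<alpha> x (es[i := r *\<^sub>R u]) = r *\<^sub>R local_rep A c \<alpha> x (es[i := u])"
    using smooth_form_lincomb_slot[OF assms, of r u 0 u] by simp
qed

lemma linear_local_rep1:
  "\<alpha> \<in> smooth_forms X A 1 \<Longrightarrow> c \<in> A \<Longrightarrow> x \<in> snd c ` fst c \<Longrightarrow> linear (\<lambda>u. local_rep A c \<alpha> x [u])"
  using linear_local_rep_slot[of \<alpha> 1 c x "[0]" 0] by simp

lemma linear_local_rep2:
  assumes "\<alpha> \<in> smooth_forms X A 2" "c \<in> A" "x \<in> snd c ` fst c"
  shows "linear (\<lambda>u. local_rep A c \<alpha> x [u, v])" "linear (\<lambda>v. local_rep A c \<alpha> x [u, v])"
  using linear_local_rep_slot[OF assms, of "[0, v]" 0] linear_local_rep_slot[OF assms, of "[u, 0]" 1]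
  by simp_all

lemma ext_deriv_lincomb:
  assumes "\<alpha> \<in> smooth_forms X A k" "\<beta> \<in> smooth_forms X A k"
  shows "ext_deriv X A k (form_lincomb a \<alpha> b \<beta>) =
    form_lincomb a (ext_deriv X A k \<alpha>) b (ext_deriv X A k \<beta>)"
proof (intro ext)
  fix p vs
  show "ext_deriv X A k (form_lincomb a \<alpha> b \<beta>) p vs =
    form_lincomb a (ext_deriv X A k \<alpha>) b (ext_deriv X A k \<beta>) p vs"
  proof (cases "p \<in> topspace X \<and> vs \<in> tangent_tuples A (Suc k) p")
    case True
    \<comment> \<open>The chosen chart depends on \<open>p\<close> alone, so all three forms are
      differentiated in the same coordinates.\<close>
    define c where "c = (SOME c. c \<in> charts_at A p)"
    define us where "us = map (\<lambda>v. v c) vs"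
    have c: "c \<in> A" "p \<in> fst c" using some_chart[of p] charts_atD[of c p] True c_def by auto
    have len: "length us = Suc k" using True by (simp add: us_def tangent_tuples_def)
    have D: "frechet_derivative (\<lambda>x. local_rep A c (form_lincomb a \<alpha> b \<beta>) x es) (at (snd c p)) u =
        a * frechet_derivative (\<lambda>x. local_rep A c \<alpha> x es) (at (snd c p)) u +
        b * frechet_derivative (\<lambda>x. local_rep A c \<beta> x es) (at (snd c p)) u"
      if "length es = k" for es u
    proof -
      have "((\<lambda>x. local_rep A c \<gamma> x es) has_derivative
          frechet_derivative (\<lambda>x. local_rep A c \<gamma> x es) (at (snd c p))) (at (snd c p))"
        if "\<gamma> \<in> smooth_forms X A k" for \<gamma>
        using smooth_on_has_derivative[OF smooth_local_rep[OF that c(1)]] c \<open>length es = k\<close> by blast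
      from has_derivative_add[OF has_derivative_mult_right[OF this[OF assms(1)]]
          has_derivative_mult_right[OF this[OF assms(2)]], of a b]
      show ?thesis
        unfolding local_rep_form_lincomb by (metis (no_types, lifting) frechet_derivative_at)
    qed
    have "length (take i us @ drop (Suc i) us) = k" if "i \<le> k" for i
      using len that by simp
    then have D': "frechet_derivative (\<lambda>x. local_rep A c (form_lincomb a \<alpha> b \<beta>) x (take i us @ drop (Suc i) us)) (at (snd c p)) u =
        a * frechet_derivative (\<lambda>x. local_rep A c \<alpha> x (take i us @ drop (Suc i) us)) (at (snd c p)) u +
        b * frechet_derivative (\<lambda>x. local_rep A c \<beta> x (take i us @ drop (Suc i) us)) (at (snd c p)) u"
      if "i \<le> k" for i u using D that by blast
    have E: "ext_deriv X A k \<gamma> p vs = (\<Sum>i\<le>k. (-1) ^ i * frechet_derivative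
        (\<lambda>x. local_rep A c \<gamma> x (take i us @ drop (Suc i) us)) (at (snd c p)) (us ! i))" for \<gamma>
      using True by (simp add: ext_deriv_def Let_def c_def us_def)
    show ?thesis
      unfolding E form_lincomb_def[of a "ext_deriv X A k \<alpha>"] sum_distrib_left sum.distrib[symmetric]
      by (rule sum.cong[OF refl]) (simp add: D' algebra_simps)
  next
    case False
    then have "ext_deriv X A k \<gamma> p vs = 0" for \<gamma> by (auto simp: ext_deriv_def)
    then show ?thesis by (simp add: form_lincomb_def[of a "ext_deriv X A k \<alpha>"])
  qed
qed

lemma ext_deriv_zero: "ext_deriv X A k (\<lambda>p vs. 0) = (\<lambda>p vs. 0)"
  by (auto simp: ext_deriv_def local_rep_def Let_def fun_eq_iff)

section \<open>Exact two-forms are smooth and closed\<close>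

abbreviation rep_deriv ::
  "('a, 'e) chart \<Rightarrow> ('a, 'e) form \<Rightarrow> 'e list \<Rightarrow> 'e \<Rightarrow> 'e \<Rightarrow> real" where
  "rep_deriv c \<alpha> es x u \<equiv> frechet_derivative (\<lambda>y. local_rep A c \<alpha> y es) (at x) u"

text \<open>The second summand is symmetric in \<open>u\<close> and \<open>v\<close>, hence cancels in the exterior derivative.\<close>

lemma rep_deriv_trans:
  assumes \<beta>: "\<beta> \<in> smooth_forms X A 1" and c: "c \<in> charts_at A p" and c': "c' \<in> charts_at A p"
  shows "rep_deriv c \<beta> [v] (snd c p) u =
    rep_deriv c' \<beta> [dtrans c c' p v] (snd c' p) (dtrans c c' p u) +
    local_rep A c' \<beta> (snd c' p)
      [frechet_derivative (\<lambda>x. frechet_derivative (transition c c') (at x) v) (at (snd c p)) u]"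
proof -
  have cA: "c \<in> A" "p \<in> fst c" "c' \<in> A" "p \<in> fst c'" using charts_atD c c' by auto
  let ?\<tau> = "transition c c'" and ?x = "snd c p" and ?S = "snd c ` (fst c \<inter> fst c')"
  let ?B = "\<lambda>b y. local_rep A c' \<beta> y [b]"
  let ?D = "\<lambda>x. frechet_derivative ?\<tau> (at x) v"
  have S: "smooth_on ?S ?\<tau>" using smooth_transition cA by blast
  have xS: "?x \<in> ?S" using cA by auto
  \<comment> \<open>Under the change of coordinates the vector argument becomes a function of x. The
    expansion moves this dependence into scalar coefficients, to which the product rule applies; the
    identity labelled \<open>3\<close> below undoes it for a constant vector.\<close>
  have exp: "?B w y = (\<Sum>b\<in>Basis. (w \<bullet> b) * ?B b y)" if "y \<in> snd c' ` fst c'" for w y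
  proof -
    interpret linear "\<lambda>u. ?B u y" using linear_local_rep1[OF \<beta> cA(3) that] .
    show ?thesis by (subst euclidean_representation[of w, symmetric]) (simp only: sum scale real_scaleR_def)
  qed
  have dB: "(?B b has_derivative frechet_derivative (?B b) (at (snd c' p))) (at (snd c' p))" for b
    using smooth_on_has_derivative[OF smooth_local_rep[OF \<beta> cA(3), of "[b]"]] cA by auto
  have d\<tau>: "(?\<tau> has_derivative dtrans c c' p) (at ?x)" using smooth_on_has_derivative[OF S xS] .
  have dB\<tau>: "((\<lambda>x. ?B b (?\<tau> x)) has_derivative
      (\<lambda>u. frechet_derivative (?B b) (at (snd c' p)) (dtrans c c' p u))) (at ?x)" for b
    using has_derivative_compose[OF d\<tau>, of "?B b"] dB cA by simp
  have dD: "(?D has_derivative frechet_derivative ?D (at ?x)) (at ?x)"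
    using smooth_on_has_derivative[OF smooth_on_deriv[OF S] xS] .
  have sumD: "((\<lambda>x. \<Sum>b\<in>Basis. (?D x \<bullet> b) * ?B b (?\<tau> x)) has_derivative
      (\<lambda>u. \<Sum>b\<in>Basis. (?D ?x \<bullet> b) * frechet_derivative (?B b) (at (snd c' p)) (dtrans c c' p u) +
        (frechet_derivative ?D (at ?x) u \<bullet> b) * ?B b (?\<tau> ?x))) (at ?x)"
    by (intro has_derivative_sum has_derivative_mult dB\<tau> has_derivative_inner_left dD)
  have eq: "(\<Sum>b\<in>Basis. (?D x \<bullet> b) * ?B b (?\<tau> x)) = local_rep A c \<beta> x [v]" if xin: "x \<in> ?S" for x
  proof -
    obtain q where q: "x = snd c q" "q \<in> fst c" "q \<in> fst c'" using xin by auto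
    have "local_rep A c \<beta> (snd c q) [v] = ?B (dtrans c c' q v) (snd c' q)"
      using local_rep_trans[of c q c' \<beta> "[v]"] charts_atI cA q by simp
    also have "\<dots> = (\<Sum>b\<in>Basis. (dtrans c c' q v \<bullet> b) * ?B b (snd c' q))"
      using exp q by blast
    finally show ?thesis using q cA by simp
  qed
  have "((\<lambda>x. local_rep A c \<beta> x [v]) has_derivative
      (\<lambda>u. \<Sum>b\<in>Basis. (?D ?x \<bullet> b) * frechet_derivative (?B b) (at (snd c' p)) (dtrans c c' p u) +
        (frechet_derivative ?D (at ?x) u \<bullet> b) * ?B b (?\<tau> ?x))) (at ?x)"
    using has_derivative_transform_within_open[OF sumD smooth_on_open[OF S] xS eq] .
  from fun_cong[OF frechet_derivative_at[OF this], of u]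
  have 1: "rep_deriv c \<beta> [v] ?x u =
      (\<Sum>b\<in>Basis. (?D ?x \<bullet> b) * frechet_derivative (?B b) (at (snd c' p)) (dtrans c c' p u)) +
      (\<Sum>b\<in>Basis. (frechet_derivative ?D (at ?x) u \<bullet> b) * ?B b (snd c' p))"
    unfolding transition_apply[OF cA(1,2)] sum.distrib by (rule sym)
  have 2: "(\<Sum>b\<in>Basis. (frechet_derivative ?D (at ?x) u \<bullet> b) * ?B b (snd c' p)) =
      ?B (frechet_derivative ?D (at ?x) u) (snd c' p)"
    by (rule exp[symmetric]) (use cA in blast)
  have 3: "(\<Sum>b\<in>Basis. (w \<bullet> b) * frechet_derivative (?B b) (at (snd c' p)) z) =
      frechet_derivative (?B w) (at (snd c' p)) z" for w z
  proof -
    have s: "((\<lambda>y. \<Sum>b\<in>Basis. (w \<bullet> b) * ?B b y) has_derivative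
        (\<lambda>z. \<Sum>b\<in>Basis. (w \<bullet> b) * frechet_derivative (?B b) (at (snd c' p)) z)) (at (snd c' p))"
      by (intro has_derivative_sum has_derivative_mult_right dB)
    have "(?B w has_derivative
        (\<lambda>z. \<Sum>b\<in>Basis. (w \<bullet> b) * frechet_derivative (?B b) (at (snd c' p)) z)) (at (snd c' p))"
      by (rule has_derivative_transform_within_open[OF s open_image_chart[OF cA(3)]])
        (use cA exp in auto)
    from fun_cong[OF frechet_derivative_at[OF this], of z] show ?thesis .
  qed
  show ?thesis unfolding 1 2 3 ..
qed

text \<open>Independence of the chart: any chart around \<open>p\<close> may replace the one picked
  by \<open>SOME\<close>. Consequently a single chart describes the derivative on its whole domain,
  which is what smoothness and a second differentiation require.\<close>

lemma ext_deriv1_tangent: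
  assumes \<beta>: "\<beta> \<in> smooth_forms X A 1" and c: "c \<in> charts_at A p"
    and v: "v \<in> tangent_space A p" and w: "w \<in> tangent_space A p"
  shows "ext_deriv X A 1 \<beta> p [v, w] =
    rep_deriv c \<beta> [w c] (snd c p) (v c) - rep_deriv c \<beta> [v c] (snd c p) (w c)"
proof -
  have p: "p \<in> topspace X" using charts_atD[OF c] by simp
  define c' where "c' = (SOME c. c \<in> charts_at A p)"
  have c': "c' \<in> charts_at A p" using some_chart[OF p] c'_def by simp
  have cA: "c \<in> A" "p \<in> fst c" "c' \<in> A" "p \<in> fst c'" using charts_atD c c' by auto
  have t: "[v, w] \<in> tangent_tuples A (Suc 1) p" using v w by (simp add: tangent_tuples_def)
  have vw: "v c' = dtrans c c' p (v c)" "w c' = dtrans c c' p (w c)"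
    using tangent_trans v w c c' by blast+
  have "ext_deriv X A 1 \<beta> p [v, w] =
      rep_deriv c' \<beta> [w c'] (snd c' p) (v c') - rep_deriv c' \<beta> [v c'] (snd c' p) (w c')"
    using p t unfolding ext_deriv_def by (simp add: Let_def c'_def[symmetric] atMost_Suc)
  moreover have "frechet_derivative (\<lambda>x. frechet_derivative (transition c c') (at x) (w c)) (at (snd c p)) (v c) =
      frechet_derivative (\<lambda>x. frechet_derivative (transition c c') (at x) (v c)) (at (snd c p)) (w c)"
    using second_derivative_symmetric[OF smooth_transition[OF cA(1,3)]] cA by blast
  ultimately show ?thesis
    unfolding rep_deriv_trans[OF \<beta> c c'] vw by simp
qed

lemma local_rep_ext_deriv1:
  assumes \<beta>: "\<beta> \<in> smooth_forms X A 1" and c: "c \<in> A" and x: "x \<in> snd c ` fst c"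
  shows "local_rep A c (ext_deriv X A 1 \<beta>) x [u, v] = rep_deriv c \<beta> [v] x u - rep_deriv c \<beta> [u] x v"
proof -
  have cc: "c \<in> charts_at A (chart_inv c x)" using charts_at_inv[OF c x] .
  show ?thesis
    using ext_deriv1_tangent[OF \<beta> cc coord_vector_tangent[OF cc, of u] coord_vector_tangent[OF cc, of v]]
    unfolding coord_vector_same[OF cc] chart_inv_right[OF x]
    by (simp only: local_rep_def[of A c "ext_deriv X A 1 \<beta>"] list.map)
qed

lemma ext_deriv1_smooth:
  assumes \<beta>: "\<beta> \<in> smooth_forms X A 1"
  shows "ext_deriv X A 1 \<beta> \<in> smooth_forms X A 2"
proof -
  define d where "d = ext_deriv X A 1 \<beta>"
  note d_apply = ext_deriv1_tangent[OF \<beta>, folded d_def]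
  have zero: "d p vs = 0" if "p \<notin> topspace X \<or> vs \<notin> tangent_tuples A 2 p" for p vs
    using that by (auto simp: d_def ext_deriv_def numeral_2_eq_2)
  have lin: "d p (vs[i := tangent_lincomb a v b w]) = a * d p (vs[i := v]) + b * d p (vs[i := w])"
    if p: "p \<in> topspace X" and vs: "vs \<in> tangent_tuples A 2 p" and i: "i < 2"
      and v: "v \<in> tangent_space A p" and w: "w \<in> tangent_space A p" for p vs i v w a b
  proof -
    obtain c where c: "c \<in> charts_at A p" using some_chart[OF p] by blast
    have cA: "c \<in> A" "p \<in> fst c" using charts_atD c by auto
    obtain v0 v1 where vs': "vs = [v0, v1]" "v0 \<in> tangent_space A p" "v1 \<in> tangent_space A p"
      using vs by (auto simp: tangent_tuples_def numeral_2_eq_2 length_Suc_conv)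
    have l: "linear (\<lambda>u. rep_deriv c \<beta> [e] (snd c p) u)" for e
      using smooth_on_differentiable[OF smooth_local_rep[OF \<beta> cA(1), of "[e]"]] cA
        linear_frechet_derivative by auto
    \<comment> \<open>Here linearity concerns the argument of the form rather than the direction of
      differentiation. It holds at all points of the open chart image and may therefore be
      differentiated.\<close>
    have l': "rep_deriv c \<beta> [a *\<^sub>R e + b *\<^sub>R f] (snd c p) u =
        a * rep_deriv c \<beta> [e] (snd c p) u + b * rep_deriv c \<beta> [f] (snd c p) u" for e f u
    proof -
      have d: "((\<lambda>x. local_rep A c \<beta> x [e]) has_derivative rep_deriv c \<beta> [e] (snd c p)) (at (snd c p))" for e
        using smooth_on_has_derivative[OF smooth_local_rep[OF \<beta> cA(1), of "[e]"]] cA by auto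
      have "((\<lambda>x. local_rep A c \<beta> x [a *\<^sub>R e + b *\<^sub>R f]) has_derivative
          (\<lambda>u. a * rep_deriv c \<beta> [e] (snd c p) u + b * rep_deriv c \<beta> [f] (snd c p) u)) (at (snd c p))"
        by (rule has_derivative_transform_within_open[OF has_derivative_add[OF
              has_derivative_mult_right[OF d] has_derivative_mult_right[OF d]]
              open_image_chart[OF cA(1)]])
          (use cA smooth_form_lincomb_slot[OF \<beta> cA(1), of _ "[0]" 0] in auto)
      then show ?thesis by (metis (no_types, lifting) frechet_derivative_at)
    qed
    have lc: "tangent_lincomb a v b w c = a *\<^sub>R v c + b *\<^sub>R w c" by (simp add: tangent_lincomb_def)
    consider "i = 0" | "i = 1" using i by linarith
    then show ?thesis
      by cases (simp_all add: vs' d_apply[OF c] v w tangent_lincomb_space lc l'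
          linear_add[OF l] linear_scale[OF l] algebra_simps)
  qed
  have alt: "d p vs = 0" if p: "p \<in> topspace X" and vs: "vs \<in> tangent_tuples A 2 p"
    and ij: "i < 2" "j < 2" "i \<noteq> j" "vs ! i = vs ! j" for p vs i j
  proof -
    obtain c where c: "c \<in> charts_at A p" using some_chart[OF p] by blast
    obtain v0 v1 where vs': "vs = [v0, v1]" "v0 \<in> tangent_space A p" "v1 \<in> tangent_space A p"
      using vs by (auto simp: tangent_tuples_def numeral_2_eq_2 length_Suc_conv)
    have "v0 = v1" using ij vs'(1) by (auto simp: less_2_cases_iff)
    then show ?thesis using vs' by (simp add: d_apply[OF c])
  qed
  have smooth: "smooth_on (snd c ` fst c) (\<lambda>x. local_rep A c d x es)"
    if c: "c \<in> A" and es: "length es = 2" for c es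
  proof -
    obtain u v where uv: "es = [u, v]" using es by (auto simp: numeral_2_eq_2 length_Suc_conv)
    have "smooth_on (snd c ` fst c) (\<lambda>x. rep_deriv c \<beta> [v] x u - rep_deriv c \<beta> [u] x v)"
      using smooth_local_rep[OF \<beta> c] by (intro smooth_on_diff smooth_on_deriv) auto
    then show ?thesis
      by (rule smooth_on_cong) (simp add: uv local_rep_ext_deriv1[OF \<beta> c, folded d_def])
  qed
  show ?thesis
    unfolding d_def[symmetric] smooth_forms_def mem_Collect_eq using zero lin alt smooth by blast
qed

text \<open>In a fixed chart the expression is an alternating sum of six second derivatives of
  coefficients, which cancel in pairs by symmetry. The inner derivative is rewritten in that chart
  on a whole neighbourhood before it is differentiated.\<close>

lemma ext_deriv_ext_deriv1:
  assumes \<beta>: "\<beta> \<in> smooth_forms X A 1"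
  shows "ext_deriv X A 2 (ext_deriv X A 1 \<beta>) = (\<lambda>p vs. 0)"
proof (intro ext)
  fix p vs
  show "ext_deriv X A 2 (ext_deriv X A 1 \<beta>) p vs = 0"
  proof (cases "p \<in> topspace X \<and> vs \<in> tangent_tuples A (Suc 2) p")
    case True
    define c where "c = (SOME c. c \<in> charts_at A p)"
    have c: "c \<in> A" "p \<in> fst c" using some_chart[of p] charts_atD[of c p] True c_def by auto
    have x: "snd c p \<in> snd c ` fst c" using c by blast
    obtain v0 v1 v2 where vs: "vs = [v0, v1, v2]"
      using True by (auto simp: tangent_tuples_def numeral_2_eq_2 length_Suc_conv)
    let ?H = "\<lambda>e u v. frechet_derivative (\<lambda>x. rep_deriv c \<beta> [e] x u) (at (snd c p)) v"
    have sm: "smooth_on (snd c ` fst c) (\<lambda>x. local_rep A c \<beta> x [e])" for e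
      using smooth_local_rep[OF \<beta> c(1)] by simp
    have H: "rep_deriv c (ext_deriv X A 1 \<beta>) [u, v] (snd c p) w = ?H v u w - ?H u v w" for u v w
    proof -
      have "((\<lambda>x. rep_deriv c \<beta> [e] x u) has_derivative ?H e u) (at (snd c p))" for e u
        using smooth_on_has_derivative[OF smooth_on_deriv[OF sm] x] .
      from has_derivative_diff[OF this this]
      have "((\<lambda>x. rep_deriv c \<beta> [v] x u - rep_deriv c \<beta> [u] x v) has_derivative
        (\<lambda>w. ?H v u w - ?H u v w)) (at (snd c p))" .
      from has_derivative_transform_within_open[OF this open_image_chart[OF c(1)] x]
      have "((\<lambda>x. local_rep A c (ext_deriv X A 1 \<beta>) x [u, v]) has_derivative
        (\<lambda>w. ?H v u w - ?H u v w)) (at (snd c p))"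
        using local_rep_ext_deriv1[OF \<beta> c(1)] by simp
      then show ?thesis by (metis (no_types, lifting) frechet_derivative_at)
    qed
    have sym: "?H e u v = ?H e v u" for e u v
      using second_derivative_symmetric_real[OF sm x] .
    have E: "ext_deriv X A 2 \<gamma> p vs =
        rep_deriv c \<gamma> [v1 c, v2 c] (snd c p) (v0 c)
        - rep_deriv c \<gamma> [v0 c, v2 c] (snd c p) (v1 c)
        + rep_deriv c \<gamma> [v0 c, v1 c] (snd c p) (v2 c)" for \<gamma>
      unfolding ext_deriv_def using True vs
      by (simp add: Let_def c_def[symmetric] numeral_2_eq_2 atMost_Suc)
    show ?thesis
      unfolding E H using sym[of "v0 c" "v1 c" "v2 c"] sym[of "v1 c" "v0 c" "v2 c"]
        sym[of "v2 c" "v0 c" "v1 c"] by simp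
  qed (auto simp: ext_deriv_def[of X A 2])
qed

lemma exact_forms_closed: "exact_forms X A 2 \<subseteq> closed_forms X A 2"
  using ext_deriv1_smooth ext_deriv_ext_deriv1
  by (auto simp: exact_forms_def closed_forms_def numeral_2_eq_2)

end

section \<open>Positive forms\<close>

context closed_atlas
begin

lemma chart_ball_cover:
  obtains F where "finite F"
    "\<And>c x r. (c, x, r) \<in> F \<Longrightarrow> c \<in> A \<and> r > 0 \<and> cball x r \<subseteq> snd c ` fst c"
    "\<And>p. p \<in> topspace X \<Longrightarrow> \<exists>(c, x, r)\<in>F. p \<in> fst c \<and> snd c p \<in> ball x r"
proof -
  define G where "G = {(c, x, r). c \<in> A \<and> (0::real) < r \<and> cball x r \<subseteq> snd c ` fst c}"
  define B where "B = (\<lambda>(c :: ('a, 'e) chart, x, r). chart_inv c ` ball x r)"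
  have "openin X U" if U: "U \<in> B ` G" for U
  proof -
    obtain c x r where "U = chart_inv c ` ball x r" "c \<in> A" "cball x r \<subseteq> snd c ` fst c"
      using U by (auto simp: G_def B_def)
    then show ?thesis
      using openin_chart_inv_image[of c "ball x r"] ball_subset_cball[of x r] by blast
  qed
  moreover have "topspace X \<subseteq> \<Union>(B ` G)"
  proof
    fix p assume "p \<in> topspace X"
    then obtain c where c: "c \<in> A" "p \<in> fst c" using cover by blast
    then obtain r where r: "r > 0" "cball (snd c p) r \<subseteq> snd c ` fst c"
      using open_image_chart[OF c(1)] unfolding open_contains_cball by blast
    have "(c, snd c p, r) \<in> G" using c r by (simp add: G_def)
    moreover have "p \<in> B (c, snd c p, r)"
      using c r by (auto simp: B_def intro!: image_eqI[of p "chart_inv c" "snd c p"])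
    ultimately show "p \<in> \<Union>(B ` G)" by blast
  qed
  ultimately obtain \<F> where \<F>: "finite \<F>" "\<F> \<subseteq> B ` G" "topspace X \<subseteq> \<Union>\<F>"
    using compact_X unfolding compact_space_alt by meson
  then obtain F where F: "F \<subseteq> G" "finite F" "\<F> = B ` F"
    using finite_subset_image by metis
  show thesis
  proof (rule that[OF F(2)])
    show FG: "c \<in> A \<and> r > 0 \<and> cball x r \<subseteq> snd c ` fst c" if "(c, x, r) \<in> F" for c x r
      using F(1) that by (auto simp: G_def)
    fix p assume "p \<in> topspace X"
    then obtain c x r where cxr: "(c, x, r) \<in> F" "p \<in> chart_inv c ` ball x r"
      using \<F>(3) F(3) by (auto simp: B_def)
    then obtain y where y: "y \<in> ball x r" "p = chart_inv c y" by blast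
    have "y \<in> snd c ` fst c" using FG[OF cxr(1)] y(1) ball_subset_cball[of x r] by blast
    then have "p \<in> fst c \<and> snd c p \<in> ball x r"
      using y chart_inv_into[of y c] chart_inv_right[of y c] by simp
    then show "\<exists>(c, x, r)\<in>F. p \<in> fst c \<and> snd c p \<in> ball x r" using cxr(1) by blast
  qed
qed

lemma local_rep2_expand:
  assumes "\<alpha> \<in> smooth_forms X A 2" "c \<in> A" "x \<in> snd c ` fst c"
  shows "local_rep A c \<alpha> x [u, v] =
    (\<Sum>i\<in>Basis. \<Sum>j\<in>Basis. (u \<bullet> i) * ((v \<bullet> j) * local_rep A c \<alpha> x [i, j]))"
proof -
  have 1: "local_rep A c \<alpha> x [u, v] = (\<Sum>i\<in>Basis. (u \<bullet> i) * local_rep A c \<alpha> x [i, v])" for v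
  proof -
    interpret linear "\<lambda>u. local_rep A c \<alpha> x [u, v]" using linear_local_rep2(1)[OF assms] .
    show ?thesis
      by (subst euclidean_representation[of u, symmetric]) (simp only: sum scale real_scaleR_def)
  qed
  have 2: "local_rep A c \<alpha> x [i, v] = (\<Sum>j\<in>Basis. (v \<bullet> j) * local_rep A c \<alpha> x [i, j])" for i
  proof -
    interpret linear "\<lambda>v. local_rep A c \<alpha> x [i, v]" using linear_local_rep2(2)[OF assms] .
    show ?thesis
      by (subst euclidean_representation[of v, symmetric]) (simp only: sum scale real_scaleR_def)
  qed
  have "(\<Sum>i\<in>Basis. (u \<bullet> i) * local_rep A c \<alpha> x [i, v]) =
    (\<Sum>i\<in>Basis. \<Sum>j\<in>Basis. (u \<bullet> i) * ((v \<bullet> j) * local_rep A c \<alpha> x [i, j]))"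
    by (rule sum.cong[OF refl], subst 2) (simp only: sum_distrib_left)
  with 1 show ?thesis by (rule trans)
qed

text \<open>Finitely many continuous functions on compact sets are involved. The bound allows any
  2-form to be scaled down to an admissible perturbation.\<close>

lemma local_rep2_bounded:
  assumes \<beta>: "\<beta> \<in> smooth_forms X A 2" and F: "finite F"
    "\<And>c K. (c, K) \<in> F \<Longrightarrow> c \<in> A \<and> compact K \<and> K \<subseteq> snd c ` fst c"
  shows "\<exists>M>0. \<forall>(c, K)\<in>F. \<forall>x\<in>K. \<forall>i\<in>Basis. \<forall>j\<in>Basis. \<bar>local_rep A c \<beta> x [i, j]\<bar> \<le> M"
proof -
  let ?S = "\<Union>z\<in>F. \<Union>i\<in>Basis. \<Union>j\<in>Basis. (\<lambda>x. local_rep A (fst z) \<beta> x [i, j]) ` snd z"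
  have "compact ?S"
  proof (intro compact_UN F(1) finite_Basis compact_continuous_image)
    fix z i j assume "z \<in> F"
    then have z: "fst z \<in> A" "compact (snd z)" "snd z \<subseteq> snd (fst z) ` fst (fst z)"
      using F(2)[of "fst z" "snd z"] by auto
    then show "compact (snd z)" by simp
    show "continuous_on (snd z) (\<lambda>x. local_rep A (fst z) \<beta> x [i, j])"
      using smooth_on_continuous_on[OF smooth_local_rep[OF \<beta> z(1), of "[i, j]"]]
        continuous_on_subset[OF _ z(3)] by simp
  qed
  then have "bounded ?S" by (rule compact_imp_bounded)
  then obtain M where M: "M > 0" "\<forall>y\<in>?S. norm y \<le> M"
    unfolding bounded_pos by blast
  have "\<bar>local_rep A c \<beta> x [i, j]\<bar> \<le> M"
    if "(c, K) \<in> F" "x \<in> K" "i \<in> Basis" "j \<in> Basis" for c K x i j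
  proof -
    have "local_rep A c \<beta> x [i, j] \<in> ?S"
      by (rule UN_I[OF that(1)], rule UN_I[OF that(3)], rule UN_I[OF that(4)]) (simp add: that(2))
    from M(2)[rule_format, OF this] show ?thesis by simp
  qed
  then show ?thesis using M(1) by auto
qed

end

section \<open>The almost complex structure in coordinates\<close>

locale closed_almost_complex = closed_atlas X A
  for X :: "'a topology" and A :: "('a, 'e::euclidean_space) chart set" +
  fixes J :: "'a \<Rightarrow> ('a, 'e) tangent \<Rightarrow> ('a, 'e) tangent"
  assumes acs: "almost_complex_structure X A J"
begin

lemma J_tangent: "p \<in> topspace X \<Longrightarrow> v \<in> tangent_space A p \<Longrightarrow> J p v \<in> tangent_space A p"
  and J_J: "p \<in> topspace X \<Longrightarrow> v \<in> tangent_space A p \<Longrightarrow> J p (J p v) = (\<lambda>c. - v c)"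
  and J_lincomb: "p \<in> topspace X \<Longrightarrow> v \<in> tangent_space A p \<Longrightarrow> w \<in> tangent_space A p \<Longrightarrow>
    J p (tangent_lincomb a v b w) = tangent_lincomb a (J p v) b (J p w)"
  using acs unfolding almost_complex_structure_def by blast+

text \<open>The coordinate matrix of \<open>J\<close>. The vector precedes the point because
  smoothness is given for each fixed vector as a function of the point.\<close>

definition J_rep :: "('a, 'e) chart \<Rightarrow> 'e \<Rightarrow> 'e \<Rightarrow> 'e" where
  "J_rep c e x = J (chart_inv c x) (coord_vector A c (chart_inv c x) e) c"

lemma J_rep_smooth: "c \<in> A \<Longrightarrow> smooth_on (snd c ` fst c) (J_rep c e)"
  using acs unfolding almost_complex_structure_def J_rep_def[abs_def] by blast

lemma J_rep_apply:
  assumes "c \<in> charts_at A p" "v \<in> tangent_space A p"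
  shows "J p v c = J_rep c (v c) (snd c p)"
  using charts_atD[OF assms(1)] coord_vector_of_tangent[OF assms] by (simp add: J_rep_def)

lemma J_rep_linear:
  assumes "c \<in> A" "x \<in> snd c ` fst c"
  shows "linear (\<lambda>e. J_rep c e x)"
proof -
  let ?p = "chart_inv c x"
  have c: "c \<in> charts_at A ?p" using charts_at_inv[OF assms] .
  have p: "?p \<in> topspace X" using charts_atD[OF c] by simp
  have *: "J_rep c (a *\<^sub>R u + b *\<^sub>R v) x = a *\<^sub>R J_rep c u x + b *\<^sub>R J_rep c v x" for a b u v
    unfolding J_rep_def coord_vector_lincomb[OF c]
      J_lincomb[OF p coord_vector_tangent[OF c] coord_vector_tangent[OF c]]
    by (simp add: tangent_lincomb_def)
  show ?thesis
    using *[of 1 _ 1] *[of _ _ 0 0] by (intro linearI) auto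
qed

lemma J_rep_expand:
  assumes "c \<in> A" "x \<in> snd c ` fst c"
  shows "J_rep c e x = (\<Sum>k\<in>Basis. (e \<bullet> k) *\<^sub>R J_rep c k x)"
proof -
  interpret linear "\<lambda>e. J_rep c e x" using J_rep_linear[OF assms] .
  show ?thesis by (subst euclidean_representation[of e, symmetric]) (simp only: sum scale)
qed

lemma taming_value:
  assumes "c \<in> charts_at A p" "v \<in> tangent_space A p"
  shows "\<omega> p [v, J p v] = local_rep A c \<omega> (snd c p) [v c, J_rep c (v c) (snd c p)]"
proof -
  have p: "p \<in> topspace X" "c \<in> A" "p \<in> fst c" using charts_atD[OF assms(1)] by auto
  show ?thesis
    using coord_vector_of_tangent[OF assms]
      coord_vector_of_tangent[OF assms(1) J_tangent[OF p(1) assms(2)]]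
    by (simp add: local_rep_apply p J_rep_apply[OF assms])
qed

lemma tangent_coord_nonzero:
  assumes "c \<in> charts_at A p" "v \<in> tangent_space A p" "v \<noteq> (\<lambda>c. 0)"
  shows "v c \<noteq> 0"
proof
  assume "v c = 0"
  then have "v c' = 0" for c'
    using tangent_trans[OF assms(2,1)] tangent_outside[OF assms(2)]
      linear_0[OF dtrans_linear[OF assms(1)]] by metis
  then show False using assms(3) by auto
qed

text \<open>On the compact product of \<open>K\<close> and the unit sphere, the taming value of
  \<omega> has a positive minimum, while the contribution of \<beta> is bounded by a constant times
  its coefficients. Both are quadratic in \<open>e\<close>, so the unit sphere decides for all
  nonzero vectors.\<close>

lemma local_tame_perturbation:
  assumes \<omega>: "\<omega> \<in> smooth_forms X A 2" and tame: "tames X A \<omega> J"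
    and c: "c \<in> A" and K: "compact K" "K \<subseteq> snd c ` fst c"
  shows "\<exists>\<delta>>0. \<forall>\<beta>\<in>smooth_forms X A 2.
    (\<forall>x\<in>K. \<forall>i\<in>Basis. \<forall>j\<in>Basis. \<bar>local_rep A c \<beta> x [i, j]\<bar> < \<delta>) \<longrightarrow>
    (\<forall>x\<in>K. \<forall>e. e \<noteq> 0 \<longrightarrow>
      local_rep A c \<omega> x [e, J_rep c e x] + local_rep A c \<beta> x [e, J_rep c e x] > 0)"
proof (cases "K = {}")
  case False
  let ?Z = "K \<times> sphere (0::'e) 1"
  have cZ: "compact ?Z" using K(1) by (intro compact_Times) auto
  obtain b :: 'e where "b \<in> Basis" using nonempty_Basis by blast
  then have neZ: "?Z \<noteq> {}" using False by (auto intro!: exI[of _ b])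
  have comp: "continuous_on ?Z (\<lambda>z. g (fst z))"
    if "smooth_on (snd c ` fst c) g" for g :: "'e \<Rightarrow> 'g::real_normed_vector"
    by (rule continuous_on_compose2[OF continuous_on_subset[OF smooth_on_continuous_on[OF that] K(2)]])
      (auto intro: continuous_intros)
  have Jx: "J_rep c e x = (\<Sum>k\<in>Basis. (e \<bullet> k) *\<^sub>R J_rep c k x)" if "x \<in> K" for x e
    using J_rep_expand[OF c] K that by blast
  \<comment> \<open>Joint continuity in point and vector comes from the basis expansion: each column
    of the matrix depends on the point only.\<close>
  have contJ: "continuous_on ?Z (\<lambda>z. J_rep c (snd z) (fst z))"
  proof -
    have "continuous_on ?Z (\<lambda>z. \<Sum>k\<in>Basis. (snd z \<bullet> k) *\<^sub>R J_rep c k (fst z))"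
      by (intro continuous_intros comp J_rep_smooth c)
    then show ?thesis
      by (rule continuous_on_eq) (rule Jx[symmetric], auto)
  qed
  have ex: "local_rep A c \<alpha> x [u, v] =
    (\<Sum>i\<in>Basis. \<Sum>j\<in>Basis. (u \<bullet> i) * ((v \<bullet> j) * local_rep A c \<alpha> x [i, j]))"
    if "\<alpha> \<in> smooth_forms X A 2" "x \<in> K" for \<alpha> x u v
    using local_rep2_expand[OF that(1) c] that(2) K(2) by blast
  have cont\<omega>: "continuous_on ?Z (\<lambda>z. local_rep A c \<omega> (fst z) [snd z, J_rep c (snd z) (fst z)])"
  proof -
    have "continuous_on ?Z (\<lambda>z. \<Sum>i\<in>Basis. \<Sum>j\<in>Basis. (snd z \<bullet> i) *
      ((J_rep c (snd z) (fst z) \<bullet> j) * local_rep A c \<omega> (fst z) [i, j]))"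
      using smooth_local_rep[OF \<omega> c] by (intro continuous_intros comp contJ) auto
    then show ?thesis
      by (rule continuous_on_eq) (rule ex[OF \<omega>, symmetric], auto)
  qed
  obtain z0 where z0: "z0 \<in> ?Z"
    "\<And>z. z \<in> ?Z \<Longrightarrow> local_rep A c \<omega> (fst z0) [snd z0, J_rep c (snd z0) (fst z0)] \<le>
      local_rep A c \<omega> (fst z) [snd z, J_rep c (snd z) (fst z)]"
    using continuous_attains_inf[OF cZ neZ cont\<omega>] by blast
  define m where "m = local_rep A c \<omega> (fst z0) [snd z0, J_rep c (snd z0) (fst z0)]"
  have mpos: "m > 0"
  proof -
    define p where "p = chart_inv c (fst z0)"
    have x: "fst z0 \<in> snd c ` fst c" using z0(1) K(2) by auto
    have cp: "c \<in> charts_at A p" unfolding p_def using charts_at_inv[OF c x] .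
    have sp: "snd c p = fst z0" unfolding p_def using chart_inv_right[OF x] .
    let ?v = "coord_vector A c p (snd z0)"
    have vc: "?v c = snd z0" using cp by simp
    then have "?v \<noteq> (\<lambda>c. 0)" using z0(1) by auto
    then have "\<omega> p [?v, J p ?v] > 0"
      using tame charts_atD[OF cp] coord_vector_tangent[OF cp] unfolding tames_def by blast
    then show ?thesis
      unfolding taming_value[OF cp coord_vector_tangent[OF cp]] vc sp m_def .
  qed
  have "continuous_on ?Z (\<lambda>z. \<Sum>i\<in>Basis. \<Sum>j\<in>Basis. \<bar>snd z \<bullet> i\<bar> * \<bar>J_rep c (snd z) (fst z) \<bullet> j\<bar>)"
    by (intro continuous_intros contJ)
  then obtain B where B: "\<And>z. z \<in> ?Z \<Longrightarrow>
      (\<Sum>i\<in>Basis. \<Sum>j\<in>Basis. \<bar>snd z \<bullet> i\<bar> * \<bar>J_rep c (snd z) (fst z) \<bullet> j\<bar>) \<le> B"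
    using continuous_attains_sup[OF cZ neZ] by blast
  have B0: "B \<ge> 0" using B[OF z0(1)] by (rule order_trans[rotated]) (intro sum_nonneg mult_nonneg_nonneg, auto)
  \<comment> \<open>On unit vectors, coefficients below \<delta> contribute at most
    \<open>\<delta> * B\<close>, which has to stay below the minimum \<open>m\<close>. Adding 1
    gives a strict inequality and covers \<open>B = 0\<close>.\<close>
  define \<delta> where "\<delta> = m / (B + 1)"
  have \<delta>: "\<delta> > 0" "\<delta> * B < m" using mpos B0 by (auto simp: \<delta>_def field_simps)
  show ?thesis
  proof (intro exI[of _ \<delta>] conjI \<delta>(1) ballI impI allI)
    fix \<beta> x and e :: 'e
    assume \<beta>: "\<beta> \<in> smooth_forms X A 2" and x: "x \<in> K" and e: "e \<noteq> 0"
      and small: "\<forall>x\<in>K. \<forall>i\<in>Basis. \<forall>j\<in>Basis. \<bar>local_rep A c \<beta> x [i, j]\<bar> < \<delta>"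
    have xc: "x \<in> snd c ` fst c" using x K(2) by blast
    define u where "u = e /\<^sub>R norm e"
    have eu: "e = norm e *\<^sub>R u" using e by (simp add: u_def)
    have zZ: "(x, u) \<in> ?Z" using x e by (simp add: u_def)
    let ?Q = "\<lambda>\<alpha> e. local_rep A c \<alpha> x [e, J_rep c e x]"
    have hom: "?Q \<alpha> (r *\<^sub>R u) = r * (r * ?Q \<alpha> u)" if \<alpha>: "\<alpha> \<in> smooth_forms X A 2" for \<alpha> r
    proof -
      have 1: "J_rep c (r *\<^sub>R u) x = r *\<^sub>R J_rep c u x"
        by (rule linear_scale[OF J_rep_linear[OF c xc]])
      have 2: "local_rep A c \<alpha> x [r *\<^sub>R u, w] = r *\<^sub>R local_rep A c \<alpha> x [u, w]" for w
        by (rule linear_scale[OF linear_local_rep2(1)[OF \<alpha> c xc]])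
      have 3: "local_rep A c \<alpha> x [u, r *\<^sub>R w] = r *\<^sub>R local_rep A c \<alpha> x [u, w]" for w
        by (rule linear_scale[OF linear_local_rep2(2)[OF \<alpha> c xc]])
      show ?thesis unfolding 1 2 3 by simp
    qed
    have "\<bar>?Q \<beta> u\<bar> \<le> (\<Sum>i\<in>Basis. \<Sum>j\<in>Basis. \<bar>(u \<bullet> i) * ((J_rep c u x \<bullet> j) * local_rep A c \<beta> x [i, j])\<bar>)"
      by (subst ex[OF \<beta> x], rule order_trans[OF sum_abs sum_mono]) (rule sum_abs)
    also have "\<dots> \<le> (\<Sum>i\<in>Basis. \<Sum>j\<in>Basis. \<delta> * (\<bar>u \<bullet> i\<bar> * \<bar>J_rep c u x \<bullet> j\<bar>))"
    proof (intro sum_mono)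
      fix i j :: 'e assume "i \<in> Basis" "j \<in> Basis"
      then have "\<bar>local_rep A c \<beta> x [i, j]\<bar> \<le> \<delta>" using small x by (simp add: less_imp_le)
      then have "(\<bar>u \<bullet> i\<bar> * \<bar>J_rep c u x \<bullet> j\<bar>) * \<bar>local_rep A c \<beta> x [i, j]\<bar> \<le> (\<bar>u \<bullet> i\<bar> * \<bar>J_rep c u x \<bullet> j\<bar>) * \<delta>"
        by (intro mult_left_mono) auto
      then show "\<bar>(u \<bullet> i) * ((J_rep c u x \<bullet> j) * local_rep A c \<beta> x [i, j])\<bar> \<le> \<delta> * (\<bar>u \<bullet> i\<bar> * \<bar>J_rep c u x \<bullet> j\<bar>)"
        by (simp add: abs_mult mult_ac)
    qed
    also have "\<dots> = \<delta> * (\<Sum>i\<in>Basis. \<Sum>j\<in>Basis. \<bar>u \<bullet> i\<bar> * \<bar>J_rep c u x \<bullet> j\<bar>)"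
      by (simp only: sum_distrib_left)
    also have "\<dots> \<le> \<delta> * B" using B[OF zZ] \<delta>(1) by (intro mult_left_mono) auto
    finally have "\<bar>?Q \<beta> u\<bar> < m" using \<delta>(2) by linarith
    moreover have "m \<le> ?Q \<omega> u" using z0(2)[OF zZ] by (simp add: m_def)
    ultimately have "?Q \<omega> u + ?Q \<beta> u > 0" by linarith
    then have "norm e * (norm e * (?Q \<omega> u + ?Q \<beta> u)) > 0" using e by simp
    also have "norm e * (norm e * (?Q \<omega> u + ?Q \<beta> u)) = ?Q \<omega> e + ?Q \<beta> e"
      using hom[OF \<omega>, of "norm e"] hom[OF \<beta>, of "norm e"] eu[symmetric]
      by (simp add: distrib_left)
    finally show "?Q \<omega> e + ?Q \<beta> e > 0" .
  qed
qed (auto intro: exI[of _ 1])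

text \<open>The least of finitely many local constants works: each tangent vector is tested in the
  chart of a ball containing its base point.\<close>

lemma tame_perturbation:
  assumes \<omega>: "\<omega> \<in> smooth_forms X A 2" and tame: "tames X A \<omega> J"
  obtains F \<delta> where "finite F" "\<delta> > 0"
    "\<And>c K. (c, K) \<in> F \<Longrightarrow> c \<in> A \<and> compact K \<and> K \<subseteq> snd c ` fst c"
    "\<And>\<beta>. \<beta> \<in> smooth_forms X A 2 \<Longrightarrow>
      (\<And>c K x i j. (c, K) \<in> F \<Longrightarrow> x \<in> K \<Longrightarrow> i \<in> Basis \<Longrightarrow> j \<in> Basis \<Longrightarrow>
        \<bar>local_rep A c \<beta> x [i, j]\<bar> < \<delta>) \<Longrightarrow> tames X A (form_lincomb 1 \<omega> 1 \<beta>) J"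
proof -
  obtain G where G: "finite G"
    "\<And>c x r. (c, x, r) \<in> G \<Longrightarrow> c \<in> A \<and> r > 0 \<and> cball x r \<subseteq> snd c ` fst c"
    "\<And>p. p \<in> topspace X \<Longrightarrow> \<exists>(c, x, r)\<in>G. p \<in> fst c \<and> snd c p \<in> ball x r"
    using chart_ball_cover by blast
  define F where "F = (\<lambda>(c, x, r). (c, cball x r)) ` G"
  have fin: "finite F" using G(1) by (simp add: F_def)
  have FA: "c \<in> A \<and> compact K \<and> K \<subseteq> snd c ` fst c" if "(c, K) \<in> F" for c K
    using that G(2) by (fastforce simp: F_def)
  let ?good = "\<lambda>c K \<delta>. \<delta> > 0 \<and> (\<forall>\<beta>\<in>smooth_forms X A 2.
    (\<forall>x\<in>K. \<forall>i\<in>Basis. \<forall>j\<in>Basis. \<bar>local_rep A c \<beta> x [i, j]\<bar> < \<delta>) \<longrightarrow>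
    (\<forall>x\<in>K. \<forall>e. e \<noteq> 0 \<longrightarrow>
      local_rep A c \<omega> x [e, J_rep c e x] + local_rep A c \<beta> x [e, J_rep c e x] > 0))"
  have "\<forall>z\<in>F. \<exists>\<delta>. ?good (fst z) (snd z) \<delta>"
  proof
    fix z assume "z \<in> F"
    then show "\<exists>\<delta>. ?good (fst z) (snd z) \<delta>"
      using FA[of "fst z" "snd z"] local_tame_perturbation[OF \<omega> tame, of "fst z" "snd z"] by simp
  qed
  then obtain d where d: "\<And>z. z \<in> F \<Longrightarrow> ?good (fst z) (snd z) (d z)" by metis
  \<comment> \<open>The inserted 1 keeps the minimum meaningful when \<open>F\<close> is empty, as
    may happen for empty \<open>X\<close>.\<close>
  define \<delta> where "\<delta> = Min (insert 1 (d ` F))"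
  have \<delta>: "\<delta> > 0" "\<And>z. z \<in> F \<Longrightarrow> \<delta> \<le> d z"
    using fin d by (auto simp: \<delta>_def Min_gr_iff)
  show thesis
  proof (rule that[OF fin \<delta>(1) FA])
    fix \<beta> assume \<beta>: "\<beta> \<in> smooth_forms X A 2"
      and small: "\<And>c K x i j. (c, K) \<in> F \<Longrightarrow> x \<in> K \<Longrightarrow> i \<in> Basis \<Longrightarrow> j \<in> Basis \<Longrightarrow>
        \<bar>local_rep A c \<beta> x [i, j]\<bar> < \<delta>"
    show "tames X A (form_lincomb 1 \<omega> 1 \<beta>) J"
      unfolding tames_def
    proof (intro ballI impI)
      fix p v assume p: "p \<in> topspace X" and v: "v \<in> tangent_space A p" "v \<noteq> (\<lambda>c. 0)"
      obtain c x r where g: "(c, x, r) \<in> G" "p \<in> fst c" "snd c p \<in> ball x r" using G(3)[OF p] by blast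
      then have cK: "(c, cball x r) \<in> F" by (force simp: F_def)
      have c: "c \<in> charts_at A p" using G(2)[OF g(1)] g(2) by (simp add: charts_atI)
      have "\<forall>y\<in>cball x r. \<forall>i\<in>Basis. \<forall>j\<in>Basis. \<bar>local_rep A c \<beta> y [i, j]\<bar> < d (c, cball x r)"
        using small[OF cK] \<delta>(2)[OF cK] less_le_trans by blast
      moreover have "snd c p \<in> cball x r" using g(3) by simp
      moreover have "v c \<noteq> 0" using tangent_coord_nonzero[OF c v] .
      ultimately have "local_rep A c \<omega> (snd c p) [v c, J_rep c (v c) (snd c p)] +
          local_rep A c \<beta> (snd c p) [v c, J_rep c (v c) (snd c p)] > 0"
        using d[OF cK] \<beta> by (simp only: fst_conv snd_conv) blast
      then show "form_lincomb 1 \<omega> 1 \<beta> p [v, J p v] > 0"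
        unfolding taming_value[OF c v(1)] local_rep_form_lincomb by simp
    qed
  qed
qed

text \<open>The 2-form \<open>\<langle>J v, w\<rangle> - \<langle>v, J w\<rangle>\<close> takes the value \<open>\<bar>J v\<bar>\<^sup>2 + \<bar>v\<bar>\<^sup>2\<close> on \<open>(v, J v)\<close>.\<close>

definition bump_form :: "('a, 'e) chart \<Rightarrow> ('e \<Rightarrow> real) \<Rightarrow> ('a, 'e) form" where
  "bump_form c h = (\<lambda>p vs. if p \<in> fst c \<and> vs \<in> tangent_tuples A 2 p
     then h (snd c p) * (J p (vs ! 0) c \<bullet> (vs ! 1) c - (vs ! 0) c \<bullet> J p (vs ! 1) c) else 0)"

lemma bump_form_apply:
  "p \<in> fst c \<Longrightarrow> v \<in> tangent_space A p \<Longrightarrow> w \<in> tangent_space A p \<Longrightarrow>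
    bump_form c h p [v, w] = h (snd c p) * (J p v c \<bullet> w c - v c \<bullet> J p w c)"
  by (simp add: bump_form_def tangent_tuples_def)

text \<open>Smoothness in another chart \<open>c'\<close> is checked near each point. In the domain
  of \<open>c\<close> the transition map supplies a formula. Elsewhere the form vanishes nearby: the
  points of \<open>X\<close> over the closed ball form a compact set, closed because
  \<open>X\<close> is Hausdorff, and contained in the domain of \<open>c\<close>.\<close>

lemma bump_form_smooth:
  assumes c: "c \<in> A" and h: "smooth_on UNIV h" "\<And>x. x \<notin> ball x0 r \<Longrightarrow> h x = 0"
    and r: "cball x0 r \<subseteq> snd c ` fst c"
  shows "bump_form c h \<in> smooth_forms X A 2"
proof -
  let ?d = "bump_form c h"
  have zero: "?d p vs = 0" if "p \<notin> topspace X \<or> vs \<notin> tangent_tuples A 2 p" for p vs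
    using that chart_subset[OF c] by (auto simp: bump_form_def)
  have zero': "?d p vs = 0" if "p \<notin> fst c" for p vs using that by (simp add: bump_form_def)
  have lin: "?d p (vs[i := tangent_lincomb a v b w]) = a * ?d p (vs[i := v]) + b * ?d p (vs[i := w])"
    if p: "p \<in> topspace X" and vs: "vs \<in> tangent_tuples A 2 p" and i: "i < 2"
      and v: "v \<in> tangent_space A p" and w: "w \<in> tangent_space A p" for p vs i v w a b
  proof (cases "p \<in> fst c")
    case True
    obtain v0 v1 where vs': "vs = [v0, v1]" "v0 \<in> tangent_space A p" "v1 \<in> tangent_space A p"
      using vs by (auto simp: tangent_tuples_def numeral_2_eq_2 length_Suc_conv)
    have lc: "tangent_lincomb a v b w c = a *\<^sub>R v c + b *\<^sub>R w c" for v w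
      by (simp add: tangent_lincomb_def)
    consider "i = 0" | "i = 1" using i by linarith
    then show ?thesis
      by cases (simp_all add: vs' bump_form_apply True v w tangent_lincomb_space
          J_lincomb[OF p v w] lc inner_add_left inner_add_right algebra_simps)
  qed (simp add: zero')
  have alt: "?d p vs = 0" if p: "p \<in> topspace X" and vs: "vs \<in> tangent_tuples A 2 p"
    and ij: "i < 2" "j < 2" "i \<noteq> j" "vs ! i = vs ! j" for p vs i j
  proof -
    obtain v0 v1 where vs': "vs = [v0, v1]" "v0 \<in> tangent_space A p" "v1 \<in> tangent_space A p"
      using vs by (auto simp: tangent_tuples_def numeral_2_eq_2 length_Suc_conv)
    have "v0 = v1" using ij vs'(1) by (auto simp: less_2_cases_iff)
    then show ?thesis
      using vs' by (cases "p \<in> fst c") (simp_all add: zero' bump_form_apply inner_commute)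
  qed
  have smooth: "smooth_on (snd c' ` fst c') (\<lambda>y. local_rep A c' ?d y es)"
    if c': "c' \<in> A" and es: "length es = 2" for c' es
  proof (rule smooth_on_local[OF _ open_image_chart[OF c']])
    obtain u v where uv: "es = [u, v]" using es by (auto simp: numeral_2_eq_2 length_Suc_conv)
    fix y0 assume y0: "y0 \<in> snd c' ` fst c'"
    let ?q = "chart_inv c' y0"
    show "\<exists>U. y0 \<in> U \<and> smooth_on U (\<lambda>y. local_rep A c' ?d y es)"
    proof (cases "?q \<in> fst c")
      case True
      let ?S = "snd c' ` (fst c' \<inter> fst c)" and ?\<tau> = "transition c' c"
      have S: "smooth_on ?S ?\<tau>" using smooth_transition c c' by blast
      have oS: "open ?S" using smooth_on_open[OF S] .
      have "y0 \<in> ?S"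
        by (rule image_eqI[where f="snd c'" and x="?q", OF chart_inv_right[OF y0, symmetric]])
          (rule IntI[OF chart_inv_into[OF y0] True])
      moreover have "smooth_on ?S (\<lambda>y. local_rep A c' ?d y es)"
      proof (rule smooth_on_cong)
        \<comment> \<open>The vector fed into the derivative of the transition map itself varies
          with \<open>y\<close>; the expansion in the basis separates the two dependences.\<close>
        let ?D = "\<lambda>y w. \<Sum>b\<in>Basis. (w \<bullet> b) *\<^sub>R frechet_derivative ?\<tau> (at y) b"
        have J: "smooth_on ?S (J_rep c' e)" for e
          using smooth_on_subset[OF J_rep_smooth[OF c'] _ oS] by blast
        have DJ: "smooth_on ?S (\<lambda>y. ?D y (J_rep c' e y))" for e
          by (intro smooth_on_sum smooth_on_scaleR smooth_on_inner J smooth_on_const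
              smooth_on_deriv S oS)
        have h\<tau>: "smooth_on ?S (\<lambda>y. h (?\<tau> y))"
          by (rule smooth_on_compose[OF h(1) S]) simp
        show "smooth_on ?S (\<lambda>y. h (?\<tau> y) *
            (?D y (J_rep c' u y) \<bullet> frechet_derivative ?\<tau> (at y) v -
             frechet_derivative ?\<tau> (at y) u \<bullet> ?D y (J_rep c' v y)))"
          by (intro smooth_on_mult h\<tau> smooth_on_diff smooth_on_inner DJ smooth_on_deriv S)
        fix y assume "y \<in> ?S"
        then obtain q where q: "q \<in> fst c'" "q \<in> fst c" "y = snd c' q" by blast
        have cq: "c' \<in> charts_at A q" "c \<in> charts_at A q" using q c c' by (auto intro: charts_atI)
        have qX: "q \<in> topspace X" using charts_atD[OF cq(1)] by simp
        let ?V = "coord_vector A c' q"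
        have V: "?V e \<in> tangent_space A q" for e using coord_vector_tangent[OF cq(1)] .
        have Vc: "?V e c = frechet_derivative ?\<tau> (at y) e" for e
          using coord_vector_apply[OF cq(2)] q(3) by simp
        have JV: "J q (?V e) c = ?D y (J_rep c' e y)" for e
        proof -
          have "J q (?V e) c = frechet_derivative ?\<tau> (at y) (J q (?V e) c')"
            using tangent_trans[OF J_tangent[OF qX V] cq] q(3) by simp
          also have "J q (?V e) c' = J_rep c' e y"
            using J_rep_apply[OF cq(1) V[of e]] coord_vector_same[OF cq(1), of e] q(3) by simp
          also have "frechet_derivative ?\<tau> (at y) w = ?D y w" for w
          proof -
            interpret linear "frechet_derivative ?\<tau> (at y)" using dtrans_linear[OF cq] q(3) by simp
            show ?thesis
              by (subst (1) euclidean_representation[of w, symmetric]) (simp only: sum scale)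
          qed
          finally show ?thesis .
        qed
        have "local_rep A c' ?d y es = ?d q [?V u, ?V v]"
          unfolding uv q(3) local_rep_apply[OF c' q(1)] by simp
        also have "\<dots> = h (snd c q) * (J q (?V u) c \<bullet> ?V v c - ?V u c \<bullet> J q (?V v) c)"
          using bump_form_apply[OF q(2) V V] .
        also have "snd c q = ?\<tau> y" using c' q by simp
        finally show "h (?\<tau> y) * (?D y (J_rep c' u y) \<bullet> frechet_derivative ?\<tau> (at y) v -
             frechet_derivative ?\<tau> (at y) u \<bullet> ?D y (J_rep c' v y)) = local_rep A c' ?d y es"
          unfolding JV Vc by (rule sym)
      qed
      ultimately have "y0 \<in> ?S \<and> smooth_on ?S (\<lambda>y. local_rep A c' ?d y es)" ..
      then show ?thesis by (rule exI)
    next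
      case False
      let ?L = "chart_inv c ` cball x0 r"
      have Lc: "?L \<subseteq> fst c" by (rule image_subsetI, rule chart_inv_into) (rule subsetD[OF r])
      have "closedin X ?L"
        using compactin_chart_inv_image[OF c compact_cball r] compactin_imp_closedin[OF Hausdorff]
        by blast
      then have oU: "openin X (topspace X - ?L)" by blast
      let ?S = "snd c' ` (fst c' \<inter> (topspace X - ?L))"
      have oS: "open ?S" using open_chart_image[OF c' oU] .
      have "?q \<in> fst c' \<inter> (topspace X - ?L)"
        by (intro IntI DiffI chart_inv_into[OF y0] subsetD[OF chart_subset[OF c'] chart_inv_into[OF y0]])
          (rule contra_subsetD[OF Lc False])
      then have "y0 \<in> ?S" by (rule image_eqI[where f="snd c'" and x="?q", OF chart_inv_right[OF y0, symmetric]])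
      moreover have "smooth_on ?S (\<lambda>y. local_rep A c' ?d y es)"
      proof (rule smooth_on_cong[OF smooth_on_const[OF oS]])
        fix y assume "y \<in> ?S"
        then obtain q where q: "q \<in> fst c'" "q \<notin> ?L" "y = snd c' q" by blast
        have "?d q vs = 0" for vs
        proof (cases "q \<in> fst c")
          case True
          have "snd c q \<notin> cball x0 r"
            using q(2) image_eqI[where f="chart_inv c" and x="snd c q", OF chart_inv_left[OF c True, symmetric]] by blast
          then have "h (snd c q) = 0" by (intro h(2)) auto
          then show ?thesis by (simp add: bump_form_def)
        qed (simp add: zero')
        then show "0 = local_rep A c' ?d y es"
          unfolding q(3) local_rep_apply[OF c' q(1)] by simp
      qed
      ultimately have "y0 \<in> ?S \<and> smooth_on ?S (\<lambda>y. local_rep A c' ?d y es)" ..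
      then show ?thesis by (rule exI)
    qed
  qed
  show ?thesis
    unfolding smooth_forms_def mem_Collect_eq using zero lin alt smooth by blast
qed

text \<open>Each bump form is nonnegative on the pairs of \<open>v\<close> and \<open>J p v\<close>,
  and the one whose ball contains the base point is strictly positive there, so their finite sum
  tames \<open>J\<close>.\<close>

lemma taming_form_exists: "\<exists>\<omega>\<in>smooth_forms X A 2. tames X A \<omega> J"
proof -
  obtain G where G: "finite G"
    "\<And>c x r. (c, x, r) \<in> G \<Longrightarrow> c \<in> A \<and> r > 0 \<and> cball x r \<subseteq> snd c ` fst c"
    "\<And>p. p \<in> topspace X \<Longrightarrow> \<exists>(c, x, r)\<in>G. p \<in> fst c \<and> snd c p \<in> ball x r"
    using chart_ball_cover by blast
  have "\<forall>z\<in>G. \<exists>h::'e \<Rightarrow> real. smooth_on UNIV h \<and> (\<forall>x. h x \<ge> 0) \<and>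
      (\<forall>x. h x > 0 \<longleftrightarrow> x \<in> ball (fst (snd z)) (snd (snd z)))"
    using G(2) by (intro ballI bump_function_exists) (auto simp: prod_eq_iff)
  from bchoice[OF this] obtain h where "\<forall>z\<in>G. smooth_on UNIV (h z) \<and> (\<forall>x. (0::real) \<le> h z x) \<and>
      (\<forall>x. h z x > 0 \<longleftrightarrow> x \<in> ball (fst (snd z)) (snd (snd z)))" ..
  then have h: "smooth_on UNIV (h z) \<and> (\<forall>x. h z x \<ge> 0) \<and>
      (\<forall>x. h z x > 0 \<longleftrightarrow> x \<in> ball (fst (snd z)) (snd (snd z)))" if "z \<in> G" for z
    using that by blast
  let ?\<Omega> = "\<lambda>z. bump_form (fst z) (h z)"
  \<comment> \<open>The index set is a variable so that smoothness of the sum follows by induction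
    on it.\<close>
  define \<omega> where "\<omega> H = (\<lambda>p vs. \<Sum>z\<in>H. ?\<Omega> z p vs)" for H
  have \<Omega>: "?\<Omega> z \<in> smooth_forms X A 2" if z: "z \<in> G" for z
  proof (rule bump_form_smooth)
    show "fst z \<in> A" "cball (fst (snd z)) (snd (snd z)) \<subseteq> snd (fst z) ` fst (fst z)"
      using G(2)[of "fst z" "fst (snd z)" "snd (snd z)"] z by auto
    show "smooth_on UNIV (h z)" using h[OF z] by blast
    show "h z x = 0" if "x \<notin> ball (fst (snd z)) (snd (snd z))" for x
      using h[OF z] that by (metis order_less_le)
  qed
  have "\<omega> H \<in> smooth_forms X A 2" if "H \<subseteq> G" for H
    using finite_subset[OF that G(1)] that
  proof (induction H)
    case empty
    then show ?case using zero_form_smooth by (simp add: \<omega>_def)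
  next
    case (insert z H)
    then have "\<omega> (insert z H) = form_lincomb 1 (?\<Omega> z) 1 (\<omega> H)"
      by (simp add: \<omega>_def form_lincomb_def)
    then show ?case using form_lincomb_smooth[OF \<Omega>] insert by simp
  qed
  then have sm: "\<omega> G \<in> smooth_forms X A 2" by blast
  have "tames X A (\<omega> G) J"
    unfolding tames_def
  proof (intro ballI impI)
    fix p v assume p: "p \<in> topspace X" and v: "v \<in> tangent_space A p" "v \<noteq> (\<lambda>c. 0)"
    have val: "?\<Omega> z p [v, J p v] =
        h z (snd (fst z) p) * (J p v (fst z) \<bullet> J p v (fst z) + v (fst z) \<bullet> v (fst z))"
      if "p \<in> fst (fst z)" for z
      using bump_form_apply[OF that v(1) J_tangent[OF p v(1)]] J_J[OF p v(1)] by simp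
    have nonneg: "?\<Omega> z p [v, J p v] \<ge> 0" if "z \<in> G" for z
    proof (cases "p \<in> fst (fst z)")
      case True
      then show ?thesis unfolding val[OF True] using h[OF that] by simp
    qed (simp add: bump_form_def)
    obtain c x r where g: "(c, x, r) \<in> G" "p \<in> fst c" "snd c p \<in> ball x r" using G(3)[OF p] by blast
    have c: "c \<in> charts_at A p" using G(2)[OF g(1)] g(2) by (simp add: charts_atI)
    have "v c \<noteq> 0" using tangent_coord_nonzero[OF c v] .
    then have "?\<Omega> (c, x, r) p [v, J p v] > 0"
      using val[of "(c, x, r)"] h[OF g(1)] g by (auto intro!: mult_pos_pos add_nonneg_pos)
    then show "\<omega> G p [v, J p v] > 0"
      unfolding \<omega>_def using nonneg g(1) G(1) by (intro sum_pos2[of G "(c, x, r)"]) auto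
  qed
  then show ?thesis using sm by blast
qed

end

section \<open>Cohomology classes and the separating current\<close>

lemma form_lincomb_eq: "form_lincomb a \<alpha> b \<beta> = a *\<^sub>R \<alpha> + b *\<^sub>R \<beta>"
  by (simp add: form_lincomb_def scaleR_fun_def plus_fun_def)

lemma subspace_formsI:
  assumes "(\<lambda>p vs. 0) \<in> S" "\<And>a b \<alpha> \<beta>. \<alpha> \<in> S \<Longrightarrow> \<beta> \<in> S \<Longrightarrow> form_lincomb a \<alpha> b \<beta> \<in> S"
  shows "subspace (S :: ('a, 'e::euclidean_space) form set)"
proof (rule subspaceI)
  show "0 \<in> S" using assms(1) by (simp add: zero_fun_def)
  show "\<alpha> + \<beta> \<in> S" if "\<alpha> \<in> S" "\<beta> \<in> S" for \<alpha> \<beta>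
    using assms(2)[OF that, of 1 1] by (simp add: form_lincomb_eq)
  show "r *\<^sub>R \<alpha> \<in> S" if "\<alpha> \<in> S" for r \<alpha>
    using assms(2)[OF that that, of r 0] by (simp add: form_lincomb_eq)
qed

context closed_atlas
begin

lemma smooth_forms_subspace: "subspace (smooth_forms X A k)"
  using zero_form_smooth form_lincomb_smooth by (rule subspace_formsI)

lemma closed_forms_subspace: "subspace (closed_forms X A k)"
proof (rule subspace_formsI)
  show "(\<lambda>p vs. 0) \<in> closed_forms X A k"
    by (simp add: closed_forms_def zero_form_smooth ext_deriv_zero)
  show "form_lincomb a \<alpha> b \<beta> \<in> closed_forms X A k"
    if "\<alpha> \<in> closed_forms X A k" "\<beta> \<in> closed_forms X A k" for a b \<alpha> \<beta>
    using that by (simp add: closed_forms_def form_lincomb_smooth ext_deriv_lincomb)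
      (simp add: form_lincomb_def)
qed

lemma exact_forms_subspace: "subspace (exact_forms X A 2)"
proof -
  have ex: "exact_forms X A 2 = ext_deriv X A 1 ` smooth_forms X A 1"
    by (simp add: exact_forms_def numeral_2_eq_2)
  show ?thesis
    unfolding ex
  proof (rule subspace_formsI)
    show "(\<lambda>p vs. 0) \<in> ext_deriv X A 1 ` smooth_forms X A 1"
      using zero_form_smooth ext_deriv_zero by (metis image_eqI)
    fix a b \<alpha> \<beta>
    assume "\<alpha> \<in> ext_deriv X A 1 ` smooth_forms X A 1" "\<beta> \<in> ext_deriv X A 1 ` smooth_forms X A 1"
    then obtain \<alpha>' \<beta>' where *: "\<alpha>' \<in> smooth_forms X A 1" "\<alpha> = ext_deriv X A 1 \<alpha>'"
      "\<beta>' \<in> smooth_forms X A 1" "\<beta> = ext_deriv X A 1 \<beta>'" by blast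
    show "form_lincomb a \<alpha> b \<beta> \<in> ext_deriv X A 1 ` smooth_forms X A 1"
      unfolding *(2,4) ext_deriv_lincomb[OF *(1,3), symmetric]
      by (intro imageI form_lincomb_smooth *)
  qed
qed

section \<open>De Rham classes and functionals on forms\<close>

lemma de_rham_class_iff:
  "\<beta> \<in> de_rham_class X A 2 \<alpha> \<longleftrightarrow> \<beta> \<in> closed_forms X A 2 \<and> \<beta> - \<alpha> \<in> exact_forms X A 2"
  by (simp add: de_rham_class_def form_lincomb_eq)

lemma de_rham_class_self: "\<alpha> \<in> closed_forms X A 2 \<Longrightarrow> \<alpha> \<in> de_rham_class X A 2 \<alpha>"
  using subspace_0[OF exact_forms_subspace] by (simp add: de_rham_class_iff)

lemma de_rham_class_eq:
  assumes "\<beta> \<in> de_rham_class X A 2 \<alpha>"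
  shows "de_rham_class X A 2 \<beta> = de_rham_class X A 2 \<alpha>"
proof -
  have e: "\<beta> - \<alpha> \<in> exact_forms X A 2" using assms by (simp add: de_rham_class_iff)
  have "\<gamma> - \<beta> \<in> exact_forms X A 2 \<longleftrightarrow> \<gamma> - \<alpha> \<in> exact_forms X A 2" for \<gamma>
    using subspace_add[OF exact_forms_subspace _ e, of "\<gamma> - \<beta>"]
      subspace_diff[OF exact_forms_subspace _ e, of "\<gamma> - \<alpha>"] by auto
  then show ?thesis by (auto simp: de_rham_class_iff)
qed

text \<open>Pulling \<open>V\<close> back from cohomology to forms gives the subspace on which the
  separating functional has to vanish.\<close>

lemma class_preimage_subspace:
  assumes "de_rham_subspace X A 2 V"
  shows "subspace {\<alpha> \<in> closed_forms X A 2. de_rham_class X A 2 \<alpha> \<in> V}"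
proof (rule subspace_formsI)
  show "(\<lambda>p vs. 0) \<in> {\<alpha> \<in> closed_forms X A 2. de_rham_class X A 2 \<alpha> \<in> V}"
    using assms subspace_0[OF closed_forms_subspace[of 2]]
    by (simp add: de_rham_subspace_def zero_fun_def)
  fix a b \<alpha> \<beta>
  assume *: "\<alpha> \<in> {\<alpha> \<in> closed_forms X A 2. de_rham_class X A 2 \<alpha> \<in> V}"
    "\<beta> \<in> {\<alpha> \<in> closed_forms X A 2. de_rham_class X A 2 \<alpha> \<in> V}"
  have "form_lincomb a \<alpha> b \<beta> \<in> closed_forms X A 2"
    using * subspace_add subspace_scale closed_forms_subspace unfolding form_lincomb_eq by blast
  then show "form_lincomb a \<alpha> b \<beta> \<in> {\<alpha> \<in> closed_forms X A 2. de_rham_class X A 2 \<alpha> \<in> V}"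
    using * assms unfolding de_rham_subspace_def by blast
qed

text \<open>The class of an exact form is the zero class. A functional that vanishes on the preimage
  of \<open>V\<close> thus has zero boundary.\<close>

lemma exact_in_class_preimage:
  assumes "de_rham_subspace X A 2 V" "\<alpha> \<in> exact_forms X A 2"
  shows "de_rham_class X A 2 \<alpha> \<in> V"
proof -
  have "\<alpha> \<in> de_rham_class X A 2 0"
    using assms(2) exact_forms_closed by (auto simp: de_rham_class_iff)
  then have "de_rham_class X A 2 \<alpha> = de_rham_class X A 2 (\<lambda>p vs. 0)"
    using de_rham_class_eq[of \<alpha> 0] by (simp add: zero_fun_def)
  then show ?thesis using assms(1) by (simp add: de_rham_subspace_def)
qed

lemma de_rham_pairing_zero:
  assumes V: "de_rham_subspace X A 2 V" and h: "h \<in> V"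
    and T: "\<And>\<alpha>. \<alpha> \<in> closed_forms X A 2 \<Longrightarrow> de_rham_class X A 2 \<alpha> \<in> V \<Longrightarrow> T \<alpha> = 0"
  shows "de_rham_pairing h T = 0"
proof -
  obtain \<alpha> where \<alpha>: "\<alpha> \<in> closed_forms X A 2" "h = de_rham_class X A 2 \<alpha>"
    using V h by (auto simp: de_rham_subspace_def de_rham_def)
  have "T \<beta> = 0" if "\<beta> \<in> h" for \<beta>
    using that T[of \<beta>] de_rham_class_eq[of \<beta> \<alpha>] h \<alpha>(2) by (auto simp: de_rham_class_iff)
  \<comment> \<open>\<open>THE\<close> selects 0 because \<open>h\<close> has a representative; for
    an empty \<open>h\<close> every real number would qualify.\<close>
  moreover have "\<alpha> \<in> h" using de_rham_class_self \<alpha> by simp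
  ultimately show ?thesis unfolding de_rham_pairing_def by (intro the_equality) auto
qed

text \<open>By linearity, a bound on one ball measured by finitely many coefficients gives an
  estimate around every form. Strong neighbourhoods of order 0 realise such balls: a finite family
  of compact sets is locally finite with all of \<open>X\<close> as the test neighbourhood.\<close>

lemma uniform_bound_imp_continuous:
  assumes F: "finite F" "\<And>c K. (c, K) \<in> F \<Longrightarrow> c \<in> A \<and> compact K \<and> K \<subseteq> snd c ` fst c"
    and lin: "\<And>a b \<alpha> \<beta>. \<alpha> \<in> smooth_forms X A 2 \<Longrightarrow> \<beta> \<in> smooth_forms X A 2 \<Longrightarrow>
      T (form_lincomb a \<alpha> b \<beta>) = a * T \<alpha> + b * T \<beta>"
    and bd: "\<And>\<beta>. \<beta> \<in> smooth_forms X A 2 \<Longrightarrow>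
      (\<And>c K x i j. (c, K) \<in> F \<Longrightarrow> x \<in> K \<Longrightarrow> i \<in> Basis \<Longrightarrow> j \<in> Basis \<Longrightarrow>
        \<bar>local_rep A c \<beta> x [i, j]\<bar> < \<delta>) \<Longrightarrow> \<bar>T \<beta>\<bar> < (C::real)"
    and \<delta>: "\<delta> > 0" and C: "C > 0"
  shows "continuous_map (strong_topology X A 2) euclideanreal T"
proof -
  have top: "topspace (strong_topology X A 2) \<subseteq> smooth_forms X A 2"
    unfolding strong_topology_def topology_generated_by_topspace
    by (auto simp: strong_nbhd_def smooth_forms_compact)
  have nbhd: "\<exists>N. openin (strong_topology X A 2) N \<and> \<alpha> \<in> N \<and> (\<forall>\<beta>\<in>N. \<bar>T \<beta> - T \<alpha>\<bar> < \<eta>)"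
    if \<alpha>: "\<alpha> \<in> smooth_forms X A 2" and \<eta>: "\<eta> > 0" for \<alpha> \<eta>
  proof -
    \<comment> \<open>A difference with coefficients below \<open>\<delta> * s\<close> becomes
      admissible for \<open>bd\<close> after division by \<open>s\<close>; scaling back yields the
      bound \<open>C * s\<close>, which equals \<eta>.\<close>
    define s where "s = \<eta> / C"
    have s: "s > 0" using \<eta> C by (simp add: s_def)
    define F' where "F' = (\<lambda>(c, K). (c, chart_inv c ` K, \<delta> * s)) ` F"
    have "control_family X A F'"
      unfolding control_family_def
    proof (intro conjI ballI)
      show "case z of (c, K, \<epsilon>) \<Rightarrow> c \<in> A \<and> compactin X K \<and> K \<subseteq> fst c \<and> 0 < \<epsilon>" if zF: "z \<in> F'" for z
      proof -
        obtain c K where z: "z = (c, chart_inv c ` K, \<delta> * s)" "(c, K) \<in> F"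
          using zF by (auto simp: F'_def)
        have K: "c \<in> A" "compact K" "K \<subseteq> snd c ` fst c" using F(2)[OF z(2)] by auto
        have "chart_inv c ` K \<subseteq> fst c"
          by (rule image_subsetI, rule chart_inv_into) (rule subsetD[OF K(3)])
        then show ?thesis
          using z(1) K compactin_chart_inv_image[OF K] \<delta> s by simp
      qed
      fix p assume "p \<in> topspace X"
      moreover have "finite {(c, K, \<epsilon>) \<in> F'. K \<inter> topspace X \<noteq> {}}"
        by (rule finite_subset[of _ F']) (auto simp: F'_def F(1))
      ultimately show "\<exists>W. openin X W \<and> p \<in> W \<and> finite {(c, K, \<epsilon>) \<in> F'. K \<inter> W \<noteq> {}}"
        by (intro exI[of _ "topspace X"]) simp
    qed
    then have op: "openin (strong_topology X A 2) (strong_nbhd X A 2 \<alpha> F' 0)"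
      unfolding strong_topology_def using \<alpha>
      by (intro topology_generated_by_Basis) (auto simp: smooth_forms_compact)
    moreover have "\<alpha> \<in> strong_nbhd X A 2 \<alpha> F' 0"
      using \<alpha> \<delta> s by (auto simp: strong_nbhd_def smooth_forms_compact F'_def)
    moreover have "\<bar>T \<beta> - T \<alpha>\<bar> < \<eta>" if N: "\<beta> \<in> strong_nbhd X A 2 \<alpha> F' 0" for \<beta>
    proof -
      have \<beta>: "\<beta> \<in> smooth_forms X A 2" using N by (simp add: strong_nbhd_def smooth_forms_compact)
      let ?\<gamma> = "form_lincomb (1/s) \<beta> (- (1/s)) \<alpha>"
      have "\<bar>T ?\<gamma>\<bar> < C"
      proof (rule bd[OF form_lincomb_smooth[OF \<beta> \<alpha>]])
        fix c K x and i j :: 'e assume *: "(c, K) \<in> F" "x \<in> K" "i \<in> Basis" "j \<in> Basis"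
        have z: "(c, chart_inv c ` K, \<delta> * s) \<in> F'" using *(1) by (force simp: F'_def)
        have x: "x \<in> snd c ` fst c" using F(2)[OF *(1)] *(2) by blast
        have "\<forall>(c, K, \<epsilon>)\<in>F'. \<forall>p\<in>K. \<forall>us\<in>lists Basis. \<forall>es\<in>lists Basis.
            length us \<le> 0 \<and> length es = 2 \<longrightarrow>
            \<bar>iter_deriv us (\<lambda>x. local_rep A c \<beta> x es - local_rep A c \<alpha> x es) (snd c p)\<bar> < \<epsilon>"
          using N unfolding strong_nbhd_def mem_Collect_eq by (rule conjunct2)
        from bspec[OF this z, unfolded prod.case, rule_format, of "chart_inv c x" "[]" "[i, j]"]
        have "\<bar>iter_deriv [] (\<lambda>x. local_rep A c \<beta> x [i, j] - local_rep A c \<alpha> x [i, j])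
            (snd c (chart_inv c x))\<bar> < \<delta> * s"
          using *(2-4) by simp
        then have "\<bar>local_rep A c \<beta> x [i, j] - local_rep A c \<alpha> x [i, j]\<bar> < \<delta> * s"
          unfolding chart_inv_right[OF x] by simp
        moreover have "local_rep A c ?\<gamma> x [i, j] =
            (local_rep A c \<beta> x [i, j] - local_rep A c \<alpha> x [i, j]) / s"
          unfolding local_rep_form_lincomb by (simp add: diff_divide_distrib)
        ultimately show "\<bar>local_rep A c ?\<gamma> x [i, j]\<bar> < \<delta>"
          using s by (simp add: abs_divide pos_divide_less_eq)
      qed
      moreover have "T ?\<gamma> = (T \<beta> - T \<alpha>) / s"
        using lin[OF \<beta> \<alpha>] by (simp add: diff_divide_distrib)
      ultimately have "\<bar>T \<beta> - T \<alpha>\<bar> < C * s"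
        using s by (simp add: abs_divide pos_divide_less_eq)
      then show ?thesis using C by (simp add: s_def)
    qed
    ultimately show ?thesis by blast
  qed
  show ?thesis
    unfolding continuous_map_def
  proof (intro conjI allI impI)
    fix U :: "real set" assume "openin euclideanreal U"
    then have U: "open U" by simp
    show "openin (strong_topology X A 2) {\<alpha> \<in> topspace (strong_topology X A 2). T \<alpha> \<in> U}"
    proof (subst openin_subopen, intro ballI)
      fix \<alpha> assume \<alpha>: "\<alpha> \<in> {\<alpha> \<in> topspace (strong_topology X A 2). T \<alpha> \<in> U}"
      then obtain \<eta> where \<eta>: "\<eta> > 0" "\<And>y. \<bar>y - T \<alpha>\<bar> < \<eta> \<Longrightarrow> y \<in> U"
        using U by (auto simp: open_dist dist_real_def)
      obtain N where N: "openin (strong_topology X A 2) N" "\<alpha> \<in> N" "\<And>\<beta>. \<beta> \<in> N \<Longrightarrow> \<bar>T \<beta> - T \<alpha>\<bar> < \<eta>"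
        using nbhd[OF _ \<eta>(1), of \<alpha>] \<alpha> top by blast
      then have "N \<subseteq> {\<alpha> \<in> topspace (strong_topology X A 2). T \<alpha> \<in> U}"
        using \<eta>(2) openin_subset by blast
      then show "\<exists>N. openin (strong_topology X A 2) N \<and> \<alpha> \<in> N \<and>
          N \<subseteq> {\<alpha> \<in> topspace (strong_topology X A 2). T \<alpha> \<in> U}"
        using N by blast
    qed
  qed auto
qed

end

section \<open>The cone of positive forms and its separation from closed forms\<close>

context closed_almost_complex
begin

lemma positive_forms_eq: "positive_forms X A J = {\<omega> \<in> smooth_forms X A 2. tames X A \<omega> J}"
  by (simp add: positive_forms_def smooth_forms_compact)

lemma positive_forms_open:
  assumes \<omega>: "\<omega> \<in> positive_forms X A J" and \<beta>: "\<beta> \<in> smooth_forms X A 2"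
  shows "\<exists>\<epsilon>>0. \<omega> + \<epsilon> *\<^sub>R \<beta> \<in> positive_forms X A J"
proof -
  have w: "\<omega> \<in> smooth_forms X A 2" "tames X A \<omega> J" using \<omega> by (auto simp: positive_forms_eq)
  obtain F \<delta> where F: "finite F" "\<delta> > 0"
    "\<And>c K. (c, K) \<in> F \<Longrightarrow> c \<in> A \<and> compact K \<and> K \<subseteq> snd c ` fst c"
    and tame: "\<And>\<beta>. \<beta> \<in> smooth_forms X A 2 \<Longrightarrow>
      (\<And>c K x i j. (c, K) \<in> F \<Longrightarrow> x \<in> K \<Longrightarrow> i \<in> Basis \<Longrightarrow> j \<in> Basis \<Longrightarrow>
        \<bar>local_rep A c \<beta> x [i, j]\<bar> < \<delta>) \<Longrightarrow> tames X A (form_lincomb 1 \<omega> 1 \<beta>) J"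
    using tame_perturbation[OF w] by metis
  obtain M where M: "M > 0" "\<forall>(c, K)\<in>F. \<forall>x\<in>K. \<forall>i\<in>Basis. \<forall>j\<in>Basis. \<bar>local_rep A c \<beta> x [i, j]\<bar> \<le> M"
    using local_rep2_bounded[OF \<beta> F(1,3)] by blast
  \<comment> \<open>Scaled coefficients are at most \<open>\<epsilon> * M\<close>, which is half of
    \<delta>, so the strict bound holds.\<close>
  define \<epsilon> where "\<epsilon> = \<delta> / (2 * M)"
  have \<epsilon>: "\<epsilon> > 0" "\<epsilon> * M < \<delta>" using M(1) F(2) by (auto simp: \<epsilon>_def)
  have s: "\<epsilon> *\<^sub>R \<beta> \<in> smooth_forms X A 2"
    using subspace_scale[OF smooth_forms_subspace \<beta>] .
  have "tames X A (form_lincomb 1 \<omega> 1 (\<epsilon> *\<^sub>R \<beta>)) J"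
  proof (rule tame[OF s])
    fix c K x and i j :: 'e assume *: "(c, K) \<in> F" "x \<in> K" "i \<in> Basis" "j \<in> Basis"
    have "\<bar>local_rep A c (\<epsilon> *\<^sub>R \<beta>) x [i, j]\<bar> = \<epsilon> * \<bar>local_rep A c \<beta> x [i, j]\<bar>"
      using \<epsilon>(1) by (simp add: local_rep_def scaleR_fun_def abs_mult)
    also have "\<dots> \<le> \<epsilon> * M" using M(2) * \<epsilon>(1) by (intro mult_left_mono) auto
    finally show "\<bar>local_rep A c (\<epsilon> *\<^sub>R \<beta>) x [i, j]\<bar> < \<delta>" using \<epsilon>(2) by linarith
  qed
  then show ?thesis
    using \<epsilon>(1) form_lincomb_smooth[OF w(1) s, of 1 1]
    by (auto simp: positive_forms_eq form_lincomb_eq)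
qed

text \<open>Nondegeneracy is witnessed by \<open>J p v\<close> as the partner of
  \<open>v\<close>.\<close>

lemma closed_positive_symplectic:
  assumes "\<omega> \<in> closed_forms X A 2" "tames X A \<omega> J"
  shows "symplectic_form X A \<omega>"
  using assms J_tangent unfolding symplectic_form_def tames_def by (metis less_numeral_extra(3))

lemma positive_current_continuous:
  assumes lin: "\<And>a b \<alpha> \<beta>. \<alpha> \<in> smooth_forms X A 2 \<Longrightarrow> \<beta> \<in> smooth_forms X A 2 \<Longrightarrow>
      T (form_lincomb a \<alpha> b \<beta>) = a * T \<alpha> + b * T \<beta>"
    and pos: "\<And>\<omega>. \<omega> \<in> positive_forms X A J \<Longrightarrow> T \<omega> > 0"
  shows "continuous_map (strong_topology X A 2) euclideanreal T"
proof -
  obtain \<omega> where w: "\<omega> \<in> smooth_forms X A 2" "tames X A \<omega> J" using taming_form_exists by blast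
  obtain F \<delta> where F: "finite F" "\<delta> > 0"
    "\<And>c K. (c, K) \<in> F \<Longrightarrow> c \<in> A \<and> compact K \<and> K \<subseteq> snd c ` fst c"
    and tame: "\<And>\<beta>. \<beta> \<in> smooth_forms X A 2 \<Longrightarrow>
      (\<And>c K x i j. (c, K) \<in> F \<Longrightarrow> x \<in> K \<Longrightarrow> i \<in> Basis \<Longrightarrow> j \<in> Basis \<Longrightarrow>
        \<bar>local_rep A c \<beta> x [i, j]\<bar> < \<delta>) \<Longrightarrow> tames X A (form_lincomb 1 \<omega> 1 \<beta>) J"
    using tame_perturbation[OF w] by metis
  show ?thesis
  proof (rule uniform_bound_imp_continuous[OF F(1,3) lin _ F(2)])
    show "T \<omega> > 0" using pos w by (simp add: positive_forms_eq)
    fix \<beta> assume \<beta>: "\<beta> \<in> smooth_forms X A 2"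
      and small: "\<And>c K x i j. (c, K) \<in> F \<Longrightarrow> x \<in> K \<Longrightarrow> i \<in> Basis \<Longrightarrow> j \<in> Basis \<Longrightarrow>
        \<bar>local_rep A c \<beta> x [i, j]\<bar> < \<delta>"
    \<comment> \<open>This is the negative of \<beta>, written as a combination because linearity of
      \<open>T\<close> is stated for \<open>form_lincomb\<close>.\<close>
    let ?n = "form_lincomb 0 \<beta> (-1) \<beta>"
    have n: "?n \<in> smooth_forms X A 2" using form_lincomb_smooth[OF \<beta> \<beta>] .
    have "tames X A (form_lincomb 1 \<omega> 1 ?n) J"
      by (rule tame[OF n]) (simp add: local_rep_form_lincomb small)
    then have "T (form_lincomb 1 \<omega> 1 ?n) > 0"
      by (intro pos) (simp add: positive_forms_eq form_lincomb_smooth w n)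
    moreover have "T (form_lincomb 1 \<omega> 1 \<beta>) > 0"
      using tame[OF \<beta> small] by (intro pos) (simp add: positive_forms_eq form_lincomb_smooth w \<beta>)
    ultimately show "\<bar>T \<beta>\<bar> < T \<omega>"
      using lin[OF w(1) n, of 1 1] lin[OF \<beta> \<beta>, of 0 "-1"] lin[OF w(1) \<beta>, of 1 1] by simp
  qed
qed

lemma separating_complex_cycle:
  assumes V: "de_rham_subspace X A 2 V"
    and no: "\<not> (\<exists>\<omega>. symplectic_form X A \<omega> \<and> tames X A \<omega> J \<and> de_rham_class X A 2 \<omega> \<in> V)"
  shows "\<exists>T. complex_cycle X A J T \<and> \<not> zero_current X A 2 T \<and>
    (\<forall>h\<in>V. de_rham_pairing h T = 0)"
proof -
  let ?W = "{\<alpha> \<in> closed_forms X A 2. de_rham_class X A 2 \<alpha> \<in> V}"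
  let ?E = "smooth_forms X A 2" and ?P = "positive_forms X A J"
  obtain \<omega>0 where \<omega>0: "\<omega>0 \<in> ?P" using taming_form_exists by (auto simp: positive_forms_eq)
  have "\<exists>T. (\<forall>x\<in>?E. \<forall>y\<in>?E. \<forall>a b. T (a *\<^sub>R x + b *\<^sub>R y) = a * T x + b * T y) \<and>
    (\<forall>x\<in>?W. T x = 0) \<and> (\<forall>p\<in>?P. T p > (0::real))"
  proof (rule open_cone_separation[OF smooth_forms_subspace class_preimage_subspace[OF V]])
    show "?W \<subseteq> ?E" by (auto simp: closed_forms_def)
    show "?P \<subseteq> ?E" by (auto simp: positive_forms_eq)
    show "?P \<noteq> {}" using \<omega>0 by blast
    show "p + q \<in> ?P" if "p \<in> ?P" "q \<in> ?P" for p q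
      using that subspace_add[OF smooth_forms_subspace, of p 2 q]
      by (simp add: positive_forms_eq tames_def add_pos_pos)
    show "r *\<^sub>R p \<in> ?P" if "p \<in> ?P" "0 < r" for p r
      using that subspace_scale[OF smooth_forms_subspace, of p 2 r]
      by (simp add: positive_forms_eq tames_def scaleR_fun_def)
    show "\<exists>\<epsilon>>0. p + \<epsilon> *\<^sub>R x \<in> ?P" if "p \<in> ?P" "x \<in> ?E" for p x
      using positive_forms_open[OF that] .
    \<comment> \<open>The hypothesis on \<open>V\<close> enters here: a form in both sets is closed
      and taming, hence symplectic, with class in \<open>V\<close>.\<close>
    show "?P \<inter> ?W = {}"
    proof (rule equals0I)
      fix \<omega> assume "\<omega> \<in> ?P \<inter> ?W"
      then have "\<omega> \<in> closed_forms X A 2" "tames X A \<omega> J" "de_rham_class X A 2 \<omega> \<in> V"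
        by (simp_all add: positive_forms_eq)
      then show False using no closed_positive_symplectic[of \<omega>] by blast
    qed
  qed
  then obtain T where lin: "\<And>x y a b. x \<in> ?E \<Longrightarrow> y \<in> ?E \<Longrightarrow> T (form_lincomb a x b y) = a * T x + b * T y"
    and W: "\<And>\<alpha>. \<alpha> \<in> ?W \<Longrightarrow> T \<alpha> = 0" and P: "\<And>p. p \<in> ?P \<Longrightarrow> T p > 0"
    unfolding form_lincomb_eq by blast
  have "current X A 2 T"
    unfolding current_def smooth_forms_compact
    by (intro conjI ballI allI lin positive_current_continuous P)
  moreover have "zero_current X A 1 (boundary X A 1 T)"
    unfolding zero_current_def boundary_def smooth_forms_compact
  proof
    fix \<beta> assume "\<beta> \<in> smooth_forms X A 1"
    then have e: "ext_deriv X A 1 \<beta> \<in> exact_forms X A 2"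
      by (simp add: exact_forms_def numeral_2_eq_2)
    then show "T (ext_deriv X A 1 \<beta>) = 0"
      using exact_in_class_preimage[OF V e] exact_forms_closed by (intro W) blast
  qed
  moreover have "\<not> zero_current X A 2 T"
    using \<omega>0 P[OF \<omega>0] unfolding zero_current_def positive_forms_def by force
  moreover have "de_rham_pairing h T = 0" if "h \<in> V" for h
    using de_rham_pairing_zero[OF V that] W by blast
  ultimately show ?thesis
    using P by (intro exI[of _ T]) (simp add: complex_cycle_def)
qed

end

theorem proposition1p7:
  fixes X :: "'a topology"
    and A :: "('a, 'e::euclidean_space) chart set"
    and J :: "'a \<Rightarrow> ('a, 'e) tangent \<Rightarrow> ('a, 'e) tangent"
    and V :: "('a, 'e) form set set"
  assumes "closed_manifold X A"
    and "almost_complex_structure X A J"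
    and "de_rham_subspace X A 2 V"
    and "\<not> (\<exists>\<omega>. symplectic_form X A \<omega> \<and> tames X A \<omega> J \<and> de_rham_class X A 2 \<omega> \<in> V)"
  shows "\<exists>T. complex_cycle X A J T \<and> \<not> zero_current X A 2 T \<and>
           (\<forall>h\<in>V. de_rham_pairing h T = 0)"
proof -
  interpret closed_almost_complex X A J using assms(1,2) by unfold_locales
  show ?thesis using separating_complex_cycle[OF assms(3,4)] .
qed

end
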